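(* Consider the equation $$\dot{x}(t)+a(t)x(t)+\sum_{k=1}^m b_k(t)x(h_k(t))=0,\quad t\geq 0,$$ where $a,b_1,\dots,b_m:[0,\infty)\to[0,\infty)$ are Lebesgue measurable, essentially bounded and nonnegative, and $h_1,\dots,h_m:[0,\infty)\to\mathbb{R}$ are Lebesgue measurable with $h_k(t)\leq t$ and $\lim_{t\to\infty}h_k(t)=\infty$ for each $k$. Suppose there is a constant $a_0$ with $a(t)\geq a_0>0$, that $b_k(t)\geq 0$, that $$h_0:=\limsup_{t\to\infty}\int_{\min_k h_k(t)}^t a(s)\,ds<\infty,$$ and that the inequality $$\frac{1}{\beta}e^{-h_0}>\ln\frac{\beta^2+\beta}{\beta^2+1}$$ holds, where $$b(t)=\sum_{k=1}^m b_k(t),\qquad \beta:=\limsup_{t\to\infty}\frac{b(t)}{a(t)}.$$ Then the equation is exponentially stable.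
   Context: The initial condition is $x(t)=\varphi(t)$ for $t\leq 0$, where $\varphi:(-\infty,0]\to\mathbb{R}$ is a Borel measurable bounded function. A solution is a function $x$ that is absolutely continuous on $[0,\infty)$ (i.e. on its bounded subintervals), satisfies the equation for almost every $t\geq 0$, and satisfies the initial condition for $t\leq 0$. The equation is exponentially stable if there exist $M>0$ and $\alpha>0$ such that for every initial function $\varphi$ the corresponding solution satisfies $|x(t)|\leq M\|\varphi\|e^{-\alpha t}$ for all $t\geq 0$, where $\|\cdot\|$ is the sup-norm. *)

theory Defs
  imports "HOL-Analysis.Analysis"
begin

definition abs_cont_on :: "real \<Rightarrow> real \<Rightarrow> (real \<Rightarrow> real) \<Rightarrow> bool" where
  "abs_cont_on c d x \<longleftrightarrow>
     (\<forall>\<epsilon>>0. \<exists>\<delta>>0. \<forall>(n::nat) u v.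
        (\<forall>i<n. c \<le> u i \<and> u i \<le> v i \<and> v i \<le> d) \<longrightarrow>
        (\<forall>i<n. \<forall>j<n. i \<noteq> j \<longrightarrow> {u i<..<v i} \<inter> {u j<..<v j} = {}) \<longrightarrow>
        (\<Sum>i<n. v i - u i) < \<delta> \<longrightarrow>
        (\<Sum>i<n. \<bar>x (v i) - x (u i)\<bar>) < \<epsilon>)"

definition ess_bounded :: "(real \<Rightarrow> real) \<Rightarrow> bool" where
  "ess_bounded f \<longleftrightarrow> (\<exists>C. AE t in lebesgue_on {0..}. \<bar>f t\<bar> \<le> C)"

(* Initial functions live on {..0}; the values of \<phi> on the positive half-line are
   irrelevant here and below. *)
definition initial_function :: "(real \<Rightarrow> real) \<Rightarrow> bool" where
  "initial_function \<phi> \<longleftrightarrow>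
     \<phi> \<in> borel_measurable (restrict_space borel {..0}) \<and> bounded (\<phi> ` {..0})"

(* An honest supremum only for functions bounded on {..0}. *)
definition sup_norm :: "(real \<Rightarrow> real) \<Rightarrow> real" where
  "sup_norm \<phi> = (SUP t\<in>{..0}. \<bar>\<phi> t\<bar>)"

definition is_solution ::
  "nat \<Rightarrow> (real \<Rightarrow> real) \<Rightarrow> (nat \<Rightarrow> real \<Rightarrow> real) \<Rightarrow> (nat \<Rightarrow> real \<Rightarrow> real)
     \<Rightarrow> (real \<Rightarrow> real) \<Rightarrow> (real \<Rightarrow> real) \<Rightarrow> bool" where
  "is_solution m a b h \<phi> x \<longleftrightarrow>
     (\<forall>T\<ge>0. abs_cont_on 0 T x) \<and>
     (AE t in lebesgue_on {0..}. x differentiable (at t) \<and>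
        deriv x t + a t * x t + (\<Sum>k=1..m. b k t * x (h k t)) = 0) \<and>
     (\<forall>t\<le>0. x t = \<phi> t)"

definition exponentially_stable ::
  "nat \<Rightarrow> (real \<Rightarrow> real) \<Rightarrow> (nat \<Rightarrow> real \<Rightarrow> real) \<Rightarrow> (nat \<Rightarrow> real \<Rightarrow> real) \<Rightarrow> bool" where
  "exponentially_stable m a b h \<longleftrightarrow>
     (\<exists>M>0. \<exists>\<alpha>>0. \<forall>\<phi>. initial_function \<phi> \<longrightarrow>
        (\<forall>x. is_solution m a b h \<phi> x \<longrightarrow>
           (\<forall>t\<ge>0. \<bar>x t\<bar> \<le> M * sup_norm \<phi> * exp (- \<alpha> * t))))"

end

theory Submission
  imports Defs
begin

text \<open>
  Write \<open>A t\<close> for the integral of \<open>a\<close> over \<open>[0, t]\<close>; measured in this time the delays are eventually at most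
  \<open>H\<close> and the total feedback gain at most \<open>\<beta>\<close>. Suppose a solution reaches a new maximum \<open>M\<close> of its absolute value,
  say \<open>x s0 = M > 0\<close>, and let \<open>s1\<close> be its last zero before \<open>s0\<close>. Integrating the equation backwards from
  \<open>s1\<close> gives \<open>- x u \<le> \<beta> M (exp (A s1 - A u) - 1)\<close>, so at time \<open>\<tau> = A t - A s1\<close> after the zero the delayed
  values satisfy \<open>- x \<le> M min 1 (\<beta> (exp (H - \<tau>) - 1))\<close>. Solving the linear equation driven by this bound
  yields \<open>x s0 \<le> K M\<close> with an explicit \<open>K\<close>, and \<open>K < 1\<close> is exactly the assumed inequality, a contradiction.
  Hence solutions stay below their maximum on a fixed initial interval. As the inequality is strict, the same holds
  for \<open>exp (\<gamma> t) x t\<close> with small \<open>\<gamma> > 0\<close>, which solves an equation of the same form with slightly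
  perturbed coefficients; this gives the exponential decay.
\<close>

subsection \<open>Absolutely continuous functions\<close>

text \<open>Tagged divisions are finite sets of pairs, while the definition counts intervals by an
  initial segment of the naturals; a bijection carries one indexing to the other.\<close>

lemma abs_cont_onD_finite:
  assumes "abs_cont_on c d f" "\<epsilon> > 0"
  shows "\<exists>\<delta>>0. \<forall>(I :: 'i set) u v. finite I \<longrightarrow> (\<forall>i\<in>I. c \<le> u i \<and> u i \<le> v i \<and> v i \<le> d) \<longrightarrow>
       (\<forall>i\<in>I. \<forall>j\<in>I. i \<noteq> j \<longrightarrow> {u i<..<v i} \<inter> {u j<..<v j} = {}) \<longrightarrow>
       (\<Sum>i\<in>I. v i - u i) < \<delta> \<longrightarrow> (\<Sum>i\<in>I. \<bar>f (v i) - f (u i)\<bar>) < \<epsilon>"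
proof -
  obtain \<delta> where \<delta>: "\<delta> > 0" and
    ac: "\<And>(n::nat) u v. \<lbrakk>\<forall>i<n. c \<le> u i \<and> u i \<le> v i \<and> v i \<le> d;
        \<forall>i<n. \<forall>j<n. i \<noteq> j \<longrightarrow> {u i<..<v i} \<inter> {u j<..<v j} = {};
        (\<Sum>i<n. v i - u i) < \<delta>\<rbrakk> \<Longrightarrow> (\<Sum>i<n. \<bar>f (v i) - f (u i)\<bar>) < \<epsilon>"
    using assms(1)[unfolded abs_cont_on_def, rule_format, OF assms(2)] by blast
  have "(\<Sum>i\<in>I. \<bar>f (v i) - f (u i)\<bar>) < \<epsilon>"
    if I: "finite I" "\<And>i. i \<in> I \<Longrightarrow> c \<le> u i \<and> u i \<le> v i \<and> v i \<le> d"
      "\<And>i j. i \<in> I \<Longrightarrow> j \<in> I \<Longrightarrow> i \<noteq> j \<Longrightarrow> {u i<..<v i} \<inter> {u j<..<v j} = {}"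
      "(\<Sum>i\<in>I. v i - u i) < \<delta>" for I :: "'i set" and u v
  proof -
    obtain g where g: "bij_betw g {..<card I} I"
      using ex_bij_betw_nat_finite[OF I(1)] by (auto simp: atLeast0LessThan)
    have gI: "g i \<in> I" if "i < card I" for i
      using g that by (auto simp: bij_betw_def)
    have ginj: "g i \<noteq> g j" if "i < card I" "j < card I" "i \<noteq> j" for i j
      using g that by (auto simp: bij_betw_def inj_on_def)
    have "(\<Sum>i<card I. \<bar>f (v (g i)) - f (u (g i))\<bar>) < \<epsilon>"
    proof (rule ac)
      show "(\<Sum>i<card I. v (g i) - u (g i)) < \<delta>"
        using I(4) sum.reindex_bij_betw[OF g, of "\<lambda>i. v i - u i"] by simp
      show "\<forall>i<card I. \<forall>j<card I. i \<noteq> j \<longrightarrow> {u (g i)<..<v (g i)} \<inter> {u (g j)<..<v (g j)} = {}"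
        using I(3) gI ginj by blast
    qed (use I(2) gI in blast)
    then show ?thesis
      using sum.reindex_bij_betw[OF g, of "\<lambda>i. \<bar>f (v i) - f (u i)\<bar>"] by simp
  qed
  with \<delta> show ?thesis
    by (intro exI[of _ \<delta>] conjI allI impI) auto
qed

text \<open>A sum of increments of \<open>F\<close> is at most \<open>B\<close> times the
  corresponding sums for \<open>f\<close> and \<open>g\<close>, so \<open>\<epsilon>\<close> is
  shared between the two. Differences, products and the exponential of \<open>A\<close> are reduced
  to this estimate.\<close>

lemma abs_cont_on_dominated:
  assumes f: "abs_cont_on c d f" and g: "abs_cont_on c d g"
    and F: "\<And>u v. c \<le> u \<Longrightarrow> u \<le> v \<Longrightarrow> v \<le> d \<Longrightarrow> \<bar>F v - F u\<bar> \<le> B * (\<bar>f v - f u\<bar> + \<bar>g v - g u\<bar>)"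
  shows "abs_cont_on c d F"
  unfolding abs_cont_on_def
proof (intro allI impI)
  fix e :: real assume "e > 0"
  define B' where "B' = max B 1"
  have B': "B' > 0" "B \<le> B'" by (auto simp: B'_def)
  define e' where "e' = e / B' / 2"
  have e': "e' > 0" using \<open>e > 0\<close> B' by (simp add: e'_def)
  obtain d1 where d1: "d1 > 0" "\<forall>(n::nat) u v. (\<forall>i<n. c \<le> u i \<and> u i \<le> v i \<and> v i \<le> d) \<longrightarrow>
        (\<forall>i<n. \<forall>j<n. i \<noteq> j \<longrightarrow> {u i<..<v i} \<inter> {u j<..<v j} = {}) \<longrightarrow>
        (\<Sum>i<n. v i - u i) < d1 \<longrightarrow> (\<Sum>i<n. \<bar>f (v i) - f (u i)\<bar>) < e'"
    using f[unfolded abs_cont_on_def, rule_format, OF e'] by (elim exE conjE)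
  obtain d2 where d2: "d2 > 0" "\<forall>(n::nat) u v. (\<forall>i<n. c \<le> u i \<and> u i \<le> v i \<and> v i \<le> d) \<longrightarrow>
        (\<forall>i<n. \<forall>j<n. i \<noteq> j \<longrightarrow> {u i<..<v i} \<inter> {u j<..<v j} = {}) \<longrightarrow>
        (\<Sum>i<n. v i - u i) < d2 \<longrightarrow> (\<Sum>i<n. \<bar>g (v i) - g (u i)\<bar>) < e'"
    using g[unfolded abs_cont_on_def, rule_format, OF e'] by (elim exE conjE)
  show "\<exists>\<delta>>0. \<forall>(n::nat) u v. (\<forall>i<n. c \<le> u i \<and> u i \<le> v i \<and> v i \<le> d) \<longrightarrow>
        (\<forall>i<n. \<forall>j<n. i \<noteq> j \<longrightarrow> {u i<..<v i} \<inter> {u j<..<v j} = {}) \<longrightarrow>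
        (\<Sum>i<n. v i - u i) < \<delta> \<longrightarrow> (\<Sum>i<n. \<bar>F (v i) - F (u i)\<bar>) < e"
  proof (intro exI[of _ "min d1 d2"] conjI allI impI)
    show "min d1 d2 > 0" using d1 d2 by simp
    fix n :: nat and u v :: "nat \<Rightarrow> real"
    assume uv: "\<forall>i<n. c \<le> u i \<and> u i \<le> v i \<and> v i \<le> d"
      "\<forall>i<n. \<forall>j<n. i \<noteq> j \<longrightarrow> {u i<..<v i} \<inter> {u j<..<v j} = {}"
      "(\<Sum>i<n. v i - u i) < min d1 d2"
    have s: "(\<Sum>i<n. v i - u i) < d1" "(\<Sum>i<n. v i - u i) < d2" using uv(3) by auto
    have 1: "(\<Sum>i<n. \<bar>f (v i) - f (u i)\<bar>) < e'" by (rule d1(2)[rule_format]) (use uv s in auto)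
    have 2: "(\<Sum>i<n. \<bar>g (v i) - g (u i)\<bar>) < e'" by (rule d2(2)[rule_format]) (use uv s in auto)
    have "(\<Sum>i<n. \<bar>F (v i) - F (u i)\<bar>) \<le> (\<Sum>i<n. B' * (\<bar>f (v i) - f (u i)\<bar> + \<bar>g (v i) - g (u i)\<bar>))"
    proof (intro sum_mono)
      fix i assume "i \<in> {..<n}"
      with uv(1) have "\<bar>F (v i) - F (u i)\<bar> \<le> B * (\<bar>f (v i) - f (u i)\<bar> + \<bar>g (v i) - g (u i)\<bar>)"
        by (intro F) auto
      also have "\<dots> \<le> B' * (\<bar>f (v i) - f (u i)\<bar> + \<bar>g (v i) - g (u i)\<bar>)"
        using B' by (intro mult_right_mono) auto
      finally show "\<bar>F (v i) - F (u i)\<bar> \<le> B' * (\<bar>f (v i) - f (u i)\<bar> + \<bar>g (v i) - g (u i)\<bar>)" .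
    qed
    also have "\<dots> = B' * ((\<Sum>i<n. \<bar>f (v i) - f (u i)\<bar>) + (\<Sum>i<n. \<bar>g (v i) - g (u i)\<bar>))"
      by (simp add: sum_distrib_left[symmetric] sum.distrib)
    also have "\<dots> < B' * (e' + e')"
      using 1 2 B' by (intro mult_strict_left_mono) auto
    also have "\<dots> = e" using B' by (simp add: e'_def)
    finally show "(\<Sum>i<n. \<bar>F (v i) - F (u i)\<bar>) < e" .
  qed
qed

lemma abs_cont_on_id: "abs_cont_on c d (\<lambda>x. x)"
  unfolding abs_cont_on_def
proof (intro allI impI)
  fix e :: real assume "e > 0"
  then show "\<exists>\<delta>>0. \<forall>(n::nat) u v. (\<forall>i<n. c \<le> u i \<and> u i \<le> v i \<and> v i \<le> d) \<longrightarrow>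
        (\<forall>i<n. \<forall>j<n. i \<noteq> j \<longrightarrow> {u i<..<v i} \<inter> {u j<..<v j} = {}) \<longrightarrow>
        (\<Sum>i<n. v i - u i) < \<delta> \<longrightarrow> (\<Sum>i<n. \<bar>v i - u i\<bar>) < e"
    by (intro exI[of _ e]) auto
qed

lemma abs_cont_on_lipschitz:
  assumes "\<And>u v. c \<le> u \<Longrightarrow> u \<le> v \<Longrightarrow> v \<le> d \<Longrightarrow> \<bar>F v - F u\<bar> \<le> L * (v - u)"
  shows "abs_cont_on c d F"
proof (rule abs_cont_on_dominated[OF abs_cont_on_id abs_cont_on_id])
  fix u v assume "c \<le> u" "u \<le> v" "v \<le> d"
  with assms[of u v] show "\<bar>F v - F u\<bar> \<le> L / 2 * (\<bar>v - u\<bar> + \<bar>v - u\<bar>)"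
    by (simp add: field_simps)
qed

lemma abs_cont_on_diff:
  assumes "abs_cont_on c d f" "abs_cont_on c d g"
  shows "abs_cont_on c d (\<lambda>t. f t - g t)"
  by (rule abs_cont_on_dominated[OF assms, where B = 1]) simp

lemma abs_cont_on_uminus:
  assumes "abs_cont_on c d f"
  shows "abs_cont_on c d (\<lambda>t. - f t)"
  by (rule abs_cont_on_dominated[OF assms assms, where B = 1]) (simp add: abs_minus_commute)

lemma abs_cont_on_subinterval:
  assumes "abs_cont_on c d f" "c \<le> c'" "d' \<le> d"
  shows "abs_cont_on c' d' f"
  unfolding abs_cont_on_def
proof (intro allI impI)
  fix e :: real assume "e > 0"
  obtain d1 where d1: "d1 > 0" "\<forall>(n::nat) u v. (\<forall>i<n. c \<le> u i \<and> u i \<le> v i \<and> v i \<le> d) \<longrightarrow>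
        (\<forall>i<n. \<forall>j<n. i \<noteq> j \<longrightarrow> {u i<..<v i} \<inter> {u j<..<v j} = {}) \<longrightarrow>
        (\<Sum>i<n. v i - u i) < d1 \<longrightarrow> (\<Sum>i<n. \<bar>f (v i) - f (u i)\<bar>) < e"
    using assms(1)[unfolded abs_cont_on_def, rule_format, OF \<open>e > 0\<close>] by (elim exE conjE)
  show "\<exists>\<delta>>0. \<forall>(n::nat) u v. (\<forall>i<n. c' \<le> u i \<and> u i \<le> v i \<and> v i \<le> d') \<longrightarrow>
        (\<forall>i<n. \<forall>j<n. i \<noteq> j \<longrightarrow> {u i<..<v i} \<inter> {u j<..<v j} = {}) \<longrightarrow>
        (\<Sum>i<n. v i - u i) < \<delta> \<longrightarrow> (\<Sum>i<n. \<bar>f (v i) - f (u i)\<bar>) < e"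
  proof (intro exI[of _ d1] conjI allI impI)
    fix n :: nat and u v :: "nat \<Rightarrow> real"
    assume uv: "\<forall>i<n. c' \<le> u i \<and> u i \<le> v i \<and> v i \<le> d'"
      "\<forall>i<n. \<forall>j<n. i \<noteq> j \<longrightarrow> {u i<..<v i} \<inter> {u j<..<v j} = {}" "(\<Sum>i<n. v i - u i) < d1"
    have "\<forall>i<n. c \<le> u i \<and> u i \<le> v i \<and> v i \<le> d"
      using uv(1) assms(2,3) by force
    with uv(2,3) show "(\<Sum>i<n. \<bar>f (v i) - f (u i)\<bar>) < e"
      using d1(2) by simp
  qed (rule d1)
qed

lemma abs_cont_on_imp_continuous_on:
  assumes "abs_cont_on c d f"
  shows "continuous_on {c..d} f"
  unfolding continuous_on_iff
proof (intro ballI allI impI)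
  fix x e :: real assume x: "x \<in> {c..d}" and "e > 0"
  obtain d1 where d1: "d1 > 0" "\<forall>(n::nat) u v. (\<forall>i<n. c \<le> u i \<and> u i \<le> v i \<and> v i \<le> d) \<longrightarrow>
        (\<forall>i<n. \<forall>j<n. i \<noteq> j \<longrightarrow> {u i<..<v i} \<inter> {u j<..<v j} = {}) \<longrightarrow>
        (\<Sum>i<n. v i - u i) < d1 \<longrightarrow> (\<Sum>i<n. \<bar>f (v i) - f (u i)\<bar>) < e"
    using assms[unfolded abs_cont_on_def, rule_format, OF \<open>e > 0\<close>] by (elim exE conjE)
  have *: "\<bar>f v - f u\<bar> < e" if "c \<le> u" "u \<le> v" "v \<le> d" "v - u < d1" for u v
    using d1(2)[rule_format, of 1 "\<lambda>_. u" "\<lambda>_. v"] that by simp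
  show "\<exists>d1>0. \<forall>y\<in>{c..d}. dist y x < d1 \<longrightarrow> dist (f y) (f x) < e"
  proof (intro exI[of _ d1] conjI ballI impI)
    fix y assume "y \<in> {c..d}" "dist y x < d1"
    then show "dist (f y) (f x) < e"
      using x *[of x y] *[of y x] by (cases "x \<le> y") (auto simp: dist_real_def abs_minus_commute)
  qed (rule d1)
qed

lemma abs_cont_on_mult:
  assumes f: "abs_cont_on c d f" and g: "abs_cont_on c d g"
  shows "abs_cont_on c d (\<lambda>t. f t * g t)"
proof -
  have "bounded (f ` {c..d})" "bounded (g ` {c..d})"
    using f g by (auto intro!: compact_imp_bounded compact_continuous_image abs_cont_on_imp_continuous_on)
  then obtain B1 B2 where B: "\<And>t. t \<in> {c..d} \<Longrightarrow> \<bar>f t\<bar> \<le> B1" "\<And>t. t \<in> {c..d} \<Longrightarrow> \<bar>g t\<bar> \<le> B2"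
    unfolding bounded_iff by (metis imageI real_norm_def)
  show ?thesis
  proof (rule abs_cont_on_dominated[OF f g])
    fix u v assume uv: "c \<le> u" "u \<le> v" "v \<le> d"
    have "f v * g v - f u * g u = g v * (f v - f u) + f u * (g v - g u)" by (simp add: algebra_simps)
    also have "\<bar>\<dots>\<bar> \<le> \<bar>g v\<bar> * \<bar>f v - f u\<bar> + \<bar>f u\<bar> * \<bar>g v - g u\<bar>"
      by (metis abs_mult abs_triangle_ineq)
    also have "\<dots> \<le> max B1 B2 * \<bar>f v - f u\<bar> + max B1 B2 * \<bar>g v - g u\<bar>"
      using uv B[of u] B[of v] by (intro add_mono mult_right_mono) auto
    finally show "\<bar>f v * g v - f u * g u\<bar> \<le> max B1 B2 * (\<bar>f v - f u\<bar> + \<bar>g v - g u\<bar>)"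
      by (simp add: algebra_simps)
  qed
qed

text \<open>A gauge argument. Near a tag outside \<open>N\<close> the sign of the derivative makes
  the increment at most a small multiple of the length. Intervals tagged in \<open>N\<close> lie in
  an open set of small measure, where absolute continuity bounds the sum of all increments. A fine
  tagged division adds up both kinds.\<close>

lemma abs_cont_on_nonincreasing:
  fixes f :: "real \<Rightarrow> real"
  assumes ac: "abs_cont_on c d f" and "c \<le> d" and N: "negligible N"
    and deriv: "\<And>t. t \<in> {c..d} - N \<Longrightarrow> \<exists>D\<le>0. (f has_real_derivative D) (at t)"
  shows "f d \<le> f c"
proof (rule field_le_epsilon)
  fix e :: real assume "e > 0"
  \<comment> \<open>Half of \<open>e\<close> is reserved for the tags outside \<open>N\<close> and
    half for those in \<open>N\<close>; the \<open>+ 1\<close> keeps the quotient meaningful when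
    \<open>c = d\<close>.\<close>
  define e1 where "e1 = e / 2 / (d - c + 1)"
  have e1: "e1 > 0" "e1 * (d - c) \<le> e / 2"
    using \<open>e > 0\<close> \<open>c \<le> d\<close> by (auto simp: e1_def field_simps)
  obtain \<delta> where \<delta>: "\<delta> > 0" and
    small: "\<forall>(I :: (real \<times> real set) set) u v. finite I \<longrightarrow> (\<forall>i\<in>I. c \<le> u i \<and> u i \<le> v i \<and> v i \<le> d) \<longrightarrow>
       (\<forall>i\<in>I. \<forall>j\<in>I. i \<noteq> j \<longrightarrow> {u i<..<v i} \<inter> {u j<..<v j} = {}) \<longrightarrow>
       (\<Sum>i\<in>I. v i - u i) < \<delta> \<longrightarrow> (\<Sum>i\<in>I. \<bar>f (v i) - f (u i)\<bar>) < e / 2"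
    using abs_cont_onD_finite[OF ac half_gt_zero[OF \<open>e > 0\<close>], where 'i = "real \<times> real set"]
    by (elim exE conjE)
  obtain U where U: "open U" "N \<subseteq> U" "U \<in> lmeasurable" "measure lebesgue U < \<delta>"
  proof -
    have NL: "N \<in> sets lebesgue" "N \<in> lmeasurable" "measure lebesgue N = 0"
      using N negligible_imp_sets negligible_imp_measurable negligible_imp_measure0 by auto
    obtain T where T: "open T" "N \<subseteq> T" "T - N \<in> lmeasurable" "emeasure lebesgue (T - N) < ennreal \<delta>"
      using sets_lebesgue_outer_open[OF NL(1) \<delta>] by metis
    have eq: "T = (T - N) \<union> N" using T(2) by blast
    have "T \<in> lmeasurable" by (subst eq) (intro fmeasurable.Un T NL)
    moreover have "measure lebesgue T \<le> measure lebesgue (T - N) + measure lebesgue N"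
      by (subst eq) (use T NL in \<open>intro measure_Un_le; auto\<close>)
    moreover have "measure lebesgue (T - N) < \<delta>"
      using T(3,4) \<delta> by (simp add: emeasure_eq_measure2 ennreal_less_iff)
    ultimately show ?thesis using that T NL by auto
  qed
  \<comment> \<open>As \<open>t\<close> lies between \<open>u\<close> and \<open>v\<close>, the
    linearization errors on the two sides add up to at most \<open>e1 * (v - u)\<close>.\<close>
  have ex: "\<exists>r>0. \<forall>u v. t \<in> {u..v} \<and> {u..v} \<subseteq> ball t r \<longrightarrow> f v - f u \<le> e1 * (v - u)"
    if t: "t \<in> {c..d} - N" for t
  proof -
    obtain D where D: "D \<le> 0" "(f has_real_derivative D) (at t)" using deriv[OF t] by blast
    then obtain r where r: "r > 0" "\<And>y. norm (y - t) < r \<Longrightarrow> norm (f y - f t - D * (y - t)) \<le> e1 * norm (y - t)"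
      using e1(1) unfolding has_field_derivative_def has_derivative_at_alt by blast
    have "f v - f u \<le> e1 * (v - u)" if uv: "t \<in> {u..v}" "{u..v} \<subseteq> ball t r" for u v
    proof -
      have "u \<in> {u..v}" "v \<in> {u..v}" using uv(1) by auto
      with uv(2) have "u \<in> ball t r" "v \<in> ball t r" by blast+
      then have "norm (u - t) < r" "norm (v - t) < r" by (auto simp: dist_real_def)
      from r(2)[OF this(1)] r(2)[OF this(2)] uv(1)
      have "f t - f u \<le> D * (t - u) + e1 * (t - u)" "f v - f t \<le> D * (v - t) + e1 * (v - t)"
        by (auto simp: algebra_simps)
      moreover have "D * (t - u) \<le> 0" "D * (v - t) \<le> 0"
        using D(1) uv(1) by (auto simp: mult_nonpos_nonneg)
      ultimately show ?thesis by (simp add: algebra_simps)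
    qed
    with r(1) show ?thesis by blast
  qed
  have "\<forall>t. \<exists>r. t \<in> {c..d} - N \<longrightarrow> r > 0 \<and> (\<forall>u v. t \<in> {u..v} \<and> {u..v} \<subseteq> ball t r \<longrightarrow> f v - f u \<le> e1 * (v - u))"
    using ex by meson
  from choice[OF this] obtain r where
    rr: "\<forall>t. t \<in> {c..d} - N \<longrightarrow> r t > 0 \<and> (\<forall>u v. t \<in> {u..v} \<and> {u..v} \<subseteq> ball t (r t) \<longrightarrow> f v - f u \<le> e1 * (v - u))"
    by (elim exE)
  have r: "r t > 0" "\<And>u v. \<lbrakk>t \<in> {u..v}; {u..v} \<subseteq> ball t (r t)\<rbrakk> \<Longrightarrow> f v - f u \<le> e1 * (v - u)"
    if "t \<in> {c..d} - N" for t
    using rr[rule_format, OF that] by simp_all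
  define \<gamma> where "\<gamma> t = (if t \<in> N then U else if t \<in> {c..d} then ball t (r t) else UNIV)" for t
  have "gauge \<gamma>"
    unfolding gauge_def using U r(1) by (auto simp: \<gamma>_def)
  then obtain p where p: "p tagged_division_of {c..d}" "\<gamma> fine p"
    using fine_division_exists_real by blast
  note pD = tagged_division_ofD[OF p(1)]
  have box: "\<exists>u v. u \<le> v \<and> K = {u..v} \<and> c \<le> u \<and> v \<le> d \<and> x \<in> {u..v}" if xK: "(x, K) \<in> p" for x K
  proof -
    obtain u v where uv: "K = {u..v}" using pD(4)[OF xK] by auto
    then show ?thesis using pD(2,3)[OF xK] by auto
  qed
  have fineD: "snd i \<subseteq> \<gamma> (fst i)" if "i \<in> p" for i
    using p(2) that by (cases i) (auto simp: fine_def)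
  define l r' where "l = (\<lambda>i::real \<times> real set. Inf (snd i))" and "r' = (\<lambda>i::real \<times> real set. Sup (snd i))"
  have lr: "l i \<le> r' i \<and> snd i = {l i..r' i} \<and> c \<le> l i \<and> r' i \<le> d \<and> fst i \<in> {l i..r' i}" if "i \<in> p" for i
  proof -
    have "(fst i, snd i) \<in> p" using that by simp
    from box[OF this] obtain u v where "u \<le> v" "snd i = {u..v}" "c \<le> u" "v \<le> d" "fst i \<in> {u..v}"
      by (elim exE conjE)
    then show ?thesis by (simp add: l_def r'_def)
  qed
  have "f d - f c = (\<Sum>i\<in>p. f (r' i) - f (l i))"
    using additive_tagged_division_1[OF \<open>c \<le> d\<close> p(1), of f] by (simp add: l_def r'_def split_def)
  also have "p = {i\<in>p. fst i \<in> N} \<union> {i\<in>p. fst i \<notin> N}" by blast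
  also have "(\<Sum>i\<in>\<dots>. f (r' i) - f (l i)) =
      (\<Sum>i\<in>{i\<in>p. fst i \<in> N}. f (r' i) - f (l i)) + (\<Sum>i\<in>{i\<in>p. fst i \<notin> N}. f (r' i) - f (l i))"
    by (rule sum.union_disjoint) (use pD(1) in auto)
  also have "(\<Sum>i\<in>{i\<in>p. fst i \<notin> N}. f (r' i) - f (l i)) \<le> (\<Sum>i\<in>{i\<in>p. fst i \<notin> N}. e1 * (r' i - l i))"
  proof (rule sum_mono)
    fix i assume i: "i \<in> {i\<in>p. fst i \<notin> N}"
    then have "snd i \<subseteq> \<gamma> (fst i)" by (intro fineD) simp
    then show "f (r' i) - f (l i) \<le> e1 * (r' i - l i)"
      using lr[of i] i by (intro r(2)[of "fst i" "l i" "r' i"]) (auto simp: \<gamma>_def split: if_splits)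
  qed
  also have "\<dots> \<le> (\<Sum>i\<in>p. e1 * (r' i - l i))"
    using lr e1(1) pD(1) by (intro sum_mono2) auto
  also have "\<dots> = e1 * (d - c)"
    using additive_tagged_division_1[OF \<open>c \<le> d\<close> p(1), of "\<lambda>x. x"]
    by (simp add: l_def r'_def split_def sum_distrib_left[symmetric])
  also have "(\<Sum>i\<in>{i\<in>p. fst i \<in> N}. f (r' i) - f (l i)) \<le> (\<Sum>i\<in>{i\<in>p. fst i \<in> N}. \<bar>f (r' i) - f (l i)\<bar>)"
    by (intro sum_mono) auto
  also have "\<dots> < e / 2"
  \<comment> \<open>By fineness an interval tagged in \<open>N\<close> lies inside \<open>U\<close>.
    The interiors are disjoint, so the total length is at most the measure of \<open>U\<close>,
    hence below \<open>\<delta>\<close>.\<close>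
  proof (rule small[rule_format])
    let ?I = "{i\<in>p. fst i \<in> N}"
    show disj: "{l i<..<r' i} \<inter> {l j<..<r' j} = {}" if "i \<in> ?I" "j \<in> ?I" "i \<noteq> j" for i j
    proof -
      have "interior (snd i) \<inter> interior (snd j) = {}"
        using that by (intro pD(5)[of "fst i" _ "fst j"]) auto
      moreover have "interior (snd i) = {l i<..<r' i}" "interior (snd j) = {l j<..<r' j}"
        using lr[of i] lr[of j] that by auto
      ultimately show ?thesis by simp
    qed
    have "(\<Sum>i\<in>?I. r' i - l i) = (\<Sum>i\<in>?I. measure lebesgue {l i<..<r' i})"
      using lr by (intro sum.cong) auto
    also have "\<dots> = measure lebesgue (\<Union>i\<in>?I. {l i<..<r' i})"
      using pD(1) disj by (intro measure_UNION'[symmetric]) (auto simp: pairwise_def disjnt_def)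
    also have "\<dots> \<le> measure lebesgue U"
    proof (intro measure_mono_fmeasurable U)
      show "(\<Union>i\<in>?I. {l i<..<r' i}) \<subseteq> U"
      proof (intro UN_least)
        fix i assume i: "i \<in> ?I"
        then have "snd i \<subseteq> \<gamma> (fst i)" by (intro fineD) simp
        then show "{l i<..<r' i} \<subseteq> U" using i lr[of i] by (auto simp: \<gamma>_def)
      qed
      show "(\<Union>i\<in>?I. {l i<..<r' i}) \<in> sets lebesgue"
        using pD(1) by (intro sets.finite_UN) auto
    qed
    also have "\<dots> < \<delta>" by (rule U)
    finally show "(\<Sum>i\<in>?I. r' i - l i) < \<delta>" .
  qed (use lr pD(1) in auto)
  finally show "f d \<le> f c + e" using e1(2) by auto
qed

text \<open>Monotonicity is applied to both \<open>f t - K * t\<close> and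
  \<open>- f t - K * t\<close>.\<close>

lemma abs_cont_on_lipschitz_of_deriv:
  fixes f :: "real \<Rightarrow> real"
  assumes ac: "abs_cont_on c d f" and cd: "c \<le> d" and N: "negligible N"
    and deriv: "\<And>t. t \<in> {c..d} - N \<Longrightarrow> \<exists>D. \<bar>D\<bar> \<le> K \<and> (f has_real_derivative D) (at t)"
  shows "\<bar>f d - f c\<bar> \<le> K * (d - c)"
proof -
  have ac_lin: "abs_cont_on c d (\<lambda>t. K * t)"
    by (rule abs_cont_on_lipschitz[of _ _ _ "\<bar>K\<bar>"]) (simp add: right_diff_distrib[symmetric] abs_mult)
  have "f d - K * d \<le> f c - K * c"
  proof (rule abs_cont_on_nonincreasing[OF abs_cont_on_diff[OF ac ac_lin] cd N])
    fix t assume "t \<in> {c..d} - N"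
    from deriv[OF this] obtain D where D: "\<bar>D\<bar> \<le> K" "(f has_real_derivative D) (at t)" by (elim exE conjE)
    have "((\<lambda>t. f t - K * t) has_real_derivative D - K * 1) (at t)"
      by (intro DERIV_diff D DERIV_cmult DERIV_ident)
    then show "\<exists>D\<le>0. ((\<lambda>t. f t - K * t) has_real_derivative D) (at t)"
      using D(1) by (intro exI[of _ "D - K"]) simp
  qed
  moreover have "- f d - K * d \<le> - f c - K * c"
  proof (rule abs_cont_on_nonincreasing[OF abs_cont_on_diff[OF abs_cont_on_uminus[OF ac] ac_lin] cd N])
    fix t assume "t \<in> {c..d} - N"
    from deriv[OF this] obtain D where D: "\<bar>D\<bar> \<le> K" "(f has_real_derivative D) (at t)" by (elim exE conjE)
    have "((\<lambda>t. - f t - K * t) has_real_derivative - D - K * 1) (at t)"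
      by (intro DERIV_diff DERIV_minus D DERIV_cmult DERIV_ident)
    then show "\<exists>D\<le>0. ((\<lambda>t. - f t - K * t) has_real_derivative D) (at t)"
      using D(1) by (intro exI[of _ "- D - K"]) simp
  qed
  ultimately show ?thesis by (simp add: algebra_simps abs_if)
qed

subsection \<open>Differentiability of the indefinite integral\<close>

lemma negligible_not_deriv_indefinite_integral:
  fixes f :: "real \<Rightarrow> real"
  assumes f: "f integrable_on {a..b}"
  shows "negligible {t \<in> {a<..<b}. \<not> ((\<lambda>u. integral {a..u} f) has_real_derivative f t) (at t)}"
proof -
  define J where "J u v = integral {u..v} f" for u v
  define E where "E \<epsilon> = {t \<in> {a<..<b}. \<forall>d>0. \<exists>u v. a \<le> u \<and> u \<le> t \<and> t \<le> v \<and> v \<le> b \<and> u < v \<and> v - u < d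
      \<and> \<bar>J u v - f t * (v - u)\<bar> > \<epsilon> * (v - u)}" for \<epsilon>
  \<comment> \<open>By Vitali, \<open>E \<epsilon>\<close> is covered up to a null set by disjoint intervals on which the integral deviates
    from its linear approximation; by the Henstock lemma the total length of such intervals is small.\<close>
  have negE: "negligible (E \<epsilon>)" if \<epsilon>: "\<epsilon> > 0" for \<epsilon>
    unfolding negligible_outer_le
  proof (intro allI impI)
    fix e :: real assume "e > 0"
    \<comment> \<open>Each selected interval deviates by more than \<open>\<epsilon>\<close> times
      its length, so the threshold \<open>e * \<epsilon>\<close> bounds their total length by
      \<open>e\<close>.\<close>
    obtain \<gamma> where \<gamma>: "gauge \<gamma>"
      "\<And>p. \<lbrakk>p tagged_partial_division_of (cbox a b); \<gamma> fine p\<rbrakk> \<Longrightarrow>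
             sum (\<lambda>(x,k). norm (measure lborel k *\<^sub>R f x - integral k f)) p < e * \<epsilon>"
      by (rule Henstock_lemma[of f a b "e * \<epsilon>"]) (use f \<open>e > 0\<close> \<epsilon> in auto)
    \<comment> \<open>A triple records a tag and an interval. The tag is kept because the Henstock
      sum evaluates \<open>f\<close> there and it need not be the midpoint; \<open>m\<close> and
      \<open>r\<close> rewrite the interval as a ball for the covering theorem.\<close>
    define K where "K = {(t, u, v). a \<le> u \<and> u \<le> t \<and> t \<le> v \<and> v \<le> b \<and> u < v \<and> {u..v} \<subseteq> \<gamma> t
      \<and> \<bar>J u v - f t * (v - u)\<bar> > \<epsilon> * (v - u)}"
    define m where "m = (\<lambda>(t::real, u::real, v::real). (u + v) / 2)"
    define r where "r = (\<lambda>(t::real, u::real, v::real). (v - u) / 2)"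
    have cb: "cball (m (t, u, v)) (r (t, u, v)) = {u..v}" for t u v
      by (auto simp: m_def r_def cball_eq_atLeastAtMost field_simps)
    have rpos: "0 < r i" if "i \<in> K" for i
      using that by (auto simp: K_def r_def)
    have fineK: "\<exists>i. i \<in> K \<and> t \<in> cball (m i) (r i) \<and> r i < d" if t: "t \<in> E \<epsilon>" and "0 < d" for t d
    proof -
      have "open (\<gamma> t)" "t \<in> \<gamma> t" using \<gamma>(1) by (auto simp: gauge_def)
      then obtain s where s: "s > 0" "ball t s \<subseteq> \<gamma> t" by (meson open_contains_ball)
      have "min s d > 0" using s(1) \<open>0 < d\<close> by simp
      then obtain u v where uv: "a \<le> u" "u \<le> t" "t \<le> v" "v \<le> b" "u < v" "v - u < min s d"
          "\<bar>J u v - f t * (v - u)\<bar> > \<epsilon> * (v - u)"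
        using t unfolding E_def by blast
      have "{u..v} \<subseteq> ball t s" using uv by (auto simp: dist_real_def)
      then have "(t, u, v) \<in> K" using uv s(2) by (auto simp: K_def)
      moreover have "t \<in> cball (m (t, u, v)) (r (t, u, v))" unfolding cb using uv by simp
      moreover have "r (t, u, v) < d" using uv by (simp add: r_def)
      ultimately show ?thesis by blast
    qed
    obtain C where C: "countable C" "C \<subseteq> K"
      "pairwise (\<lambda>i j. disjnt (cball (m i) (r i)) (cball (m j) (r j))) C"
      "negligible (E \<epsilon> - (\<Union>i\<in>C. cball (m i) (r i)))"
      using Vitali_covering_theorem_cballs[OF rpos fineK] by blast
    have bound: "measure lebesgue (\<Union>i\<in>F. cball (m i) (r i)) \<le> e" if F: "F \<subseteq> C" "finite F" for F
    proof -
      define T where "T = (\<lambda>i::real \<times> real \<times> real. (fst i, cball (m i) (r i)))"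
      have FK: "F \<subseteq> K" using F C by auto
      have disj: "cball (m i) (r i) \<inter> cball (m j) (r j) = {}" if "i \<in> F" "j \<in> F" "i \<noteq> j" for i j
        using C(3) F that unfolding pairwise_def disjnt_def by blast
      have ne: "cball (m i) (r i) \<noteq> {}" if "i \<in> F" for i
        using rpos[of i] FK that by auto
      have inj: "inj_on T F"
        unfolding inj_on_def T_def using disj ne by fastforce
      have KD: "a \<le> u \<and> u \<le> t \<and> t \<le> v \<and> v \<le> b \<and> u < v \<and> {u..v} \<subseteq> \<gamma> t
          \<and> \<bar>J u v - f t * (v - u)\<bar> > \<epsilon> * (v - u)" if "(t, u, v) \<in> F" for t u v
        using FK that by (auto simp: K_def)
      have tp: "T ` F tagged_partial_division_of (cbox a b)"
        unfolding tagged_partial_division_of_def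
      proof (intro conjI allI impI)
        show "finite (T ` F)" using F by simp
      next
        fix x k assume "(x, k) \<in> T ` F"
        then obtain u v where "(x, u, v) \<in> F" "k = {u..v}" by (auto simp: T_def cb)
        with KD[of x u v] show "x \<in> k" "k \<subseteq> cbox a b" "\<exists>a b. k = cbox a b" by auto
      next
        fix x1 k1 x2 k2 assume "(x1, k1) \<in> T ` F \<and> (x2, k2) \<in> T ` F \<and> (x1, k1) \<noteq> (x2, k2)"
        then obtain i j where ij: "i \<in> F" "j \<in> F" "T i \<noteq> T j" "(x1, k1) = T i" "(x2, k2) = T j"
          by (metis imageE)
        then have "i \<noteq> j" "k1 = cball (m i) (r i)" "k2 = cball (m j) (r j)"
          by (auto simp: T_def simp del: cball_eq_atLeastAtMost)
        with ij disj[of i j] interior_subset[of k1] interior_subset[of k2]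
        show "interior k1 \<inter> interior k2 = {}" by blast
      qed
      have "\<gamma> fine (T ` F)"
        unfolding fine_def
      proof (intro ballI)
        fix z assume "z \<in> T ` F"
        then obtain x u v where "(x, u, v) \<in> F" "z = (x, {u..v})" by (auto simp: T_def cb)
        then show "case z of (x, k) \<Rightarrow> k \<subseteq> \<gamma> x" using KD[of x u v] by simp
      qed
      note H = \<gamma>(2)[OF tp this]
      have summand: "\<epsilon> * measure lebesgue (cball (m i) (r i))
          \<le> norm (measure lborel (cball (m i) (r i)) *\<^sub>R f (fst i) - integral (cball (m i) (r i)) f)"
        if i: "i \<in> F" for i
      proof -
        obtain t u v where [simp]: "i = (t, u, v)" by (cases i)
        show ?thesis using KD[of t u v] i by (simp add: cb J_def algebra_simps abs_minus_commute)
      qed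
      have "\<epsilon> * measure lebesgue (\<Union>i\<in>F. cball (m i) (r i)) = \<epsilon> * (\<Sum>i\<in>F. measure lebesgue (cball (m i) (r i)))"
        using F(2) disj by (subst measure_UNION') (auto simp: pairwise_def disjnt_def)
      also have "\<dots> \<le> (\<Sum>i\<in>F. norm (measure lborel (cball (m i) (r i)) *\<^sub>R f (fst i) - integral (cball (m i) (r i)) f))"
        unfolding sum_distrib_left by (intro sum_mono summand)
      also have "\<dots> = sum (\<lambda>(x,k). norm (measure lborel k *\<^sub>R f x - integral k f)) (T ` F)"
        by (subst sum.reindex[OF inj]) (simp add: T_def)
      also have "\<dots> < e * \<epsilon>" by (rule H)
      finally show ?thesis using \<epsilon> by (simp add: mult.commute)
    qed
    let ?W = "\<Union>i\<in>C. cball (m i) (r i)"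
    have W: "?W \<in> lmeasurable" "measure lebesgue ?W \<le> e"
      using fmeasurable_UN_bound[OF C(1) _ bound] measure_UN_bound[OF C(1) _ bound] by auto
    have Z: "E \<epsilon> - ?W \<in> lmeasurable" "measure lebesgue (E \<epsilon> - ?W) = 0"
      using C(4) negligible_imp_measurable negligible_imp_measure0 by auto
    show "\<exists>T. E \<epsilon> \<subseteq> T \<and> T \<in> lmeasurable \<and> measure lebesgue T \<le> e"
    proof (intro exI conjI)
      show "E \<epsilon> \<subseteq> ?W \<union> (E \<epsilon> - ?W)" by blast
      show "?W \<union> (E \<epsilon> - ?W) \<in> lmeasurable" by (intro fmeasurable.Un W Z)
      have "measure lebesgue (?W \<union> (E \<epsilon> - ?W)) \<le> measure lebesgue ?W + measure lebesgue (E \<epsilon> - ?W)"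
        by (intro measure_Un_le fmeasurableD W Z)
      then show "measure lebesgue (?W \<union> (E \<epsilon> - ?W)) \<le> e" using W Z by simp
    qed
  qed
  have J: "J a v - J a u = J u v" if "a \<le> u" "u \<le> v" "v \<le> b" for u v
    using Henstock_Kurzweil_Integration.integral_combine[of a u v f] that f
    by (auto simp: J_def integrable_on_subinterval)
  \<comment> \<open>Outside every \<open>E (inverse (Suc n))\<close> the deviation on short
    intervals around \<open>t\<close> is controlled; those having \<open>t\<close> as an endpoint
    give the two one-sided difference quotients.\<close>
  have "((\<lambda>u. integral {a..u} f) has_real_derivative f t) (at t)"
    if t: "t \<in> {a<..<b}" "\<And>n. t \<notin> E (inverse (Suc n))" for t
    unfolding has_field_derivative_def has_derivative_at_alt
  proof (intro conjI allI impI bounded_linear_mult_right)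
    fix e :: real assume "e > 0"
    then obtain n where n: "inverse (Suc n) < e" using reals_Archimedean by auto
    have "\<exists>d>0. \<not> (\<exists>u v. a \<le> u \<and> u \<le> t \<and> t \<le> v \<and> v \<le> b \<and> u < v \<and> v - u < d
        \<and> \<bar>J u v - f t * (v - u)\<bar> > inverse (Suc n) * (v - u))"
      using t(1) t(2)[of n] unfolding E_def mem_Collect_eq by blast
    then obtain d where "d > 0" and nex: "\<not> (\<exists>u v. a \<le> u \<and> u \<le> t \<and> t \<le> v \<and> v \<le> b \<and> u < v \<and> v - u < d
        \<and> \<bar>J u v - f t * (v - u)\<bar> > inverse (Suc n) * (v - u))"
      by (elim exE conjE)
    have d: "\<bar>J u v - f t * (v - u)\<bar> \<le> inverse (Suc n) * (v - u)"
      if "a \<le> u" "u \<le> t" "t \<le> v" "v \<le> b" "u < v" "v - u < d" for u v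
      using nex that by (meson not_le)
    let ?d = "min d (min (t - a) (b - t))"
    show "\<exists>d>0. \<forall>y. norm (y - t) < d \<longrightarrow>
        norm (integral {a..y} f - integral {a..t} f - f t * (y - t)) \<le> e * norm (y - t)"
    proof (intro exI[of _ ?d] conjI allI impI)
      show "?d > 0" using \<open>d > 0\<close> t by auto
      fix y assume y: "norm (y - t) < ?d"
      have "\<bar>J a y - J a t - f t * (y - t)\<bar> \<le> inverse (Suc n) * \<bar>y - t\<bar>"
      proof (cases y t rule: linorder_cases)
        case less
        then show ?thesis using d[of y t] J[of y t] y t by (auto simp: abs_if algebra_simps split: if_splits)
      next
        case greater
        then show ?thesis using d[of t y] J[of t y] y t by (auto simp: abs_if algebra_simps split: if_splits)
      qed simp
      also have "\<dots> \<le> e * \<bar>y - t\<bar>" using n by (intro mult_right_mono) auto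
      finally show "norm (integral {a..y} f - integral {a..t} f - f t * (y - t)) \<le> e * norm (y - t)"
        by (simp add: J_def)
    qed
  qed
  then have "{t \<in> {a<..<b}. \<not> ((\<lambda>u. integral {a..u} f) has_real_derivative f t) (at t)}
      \<subseteq> (\<Union>n. E (inverse (Suc n)))"
    by blast
  moreover have "negligible (\<Union>n. E (inverse (Suc n)))"
    by (intro negligible_countable_Union) (auto intro: negE)
  ultimately show ?thesis by (rule negligible_subset[rotated])
qed

subsection \<open>The maximum principle\<close>

text \<open>The left-hand side is the bound for \<open>x s2 / M\<close> reached at the end of
  \<open>no_new_peak\<close>, where \<open>q = exp (- H)\<close> and \<open>r\<close> depends on the
  position of \<open>s2\<close>. The estimate has to be uniform in \<open>r\<close>, which follows
  from \<open>ln y \<le> y - 1\<close> at \<open>y = R / r\<close>.\<close>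

lemma peak_factor_less_one:
  fixes \<beta> q r :: real
  assumes "\<beta> > 0" "r > 0" and cond: "ln ((\<beta>\<^sup>2 + \<beta>) / (\<beta>\<^sup>2 + 1)) < q / \<beta>"
  shows "r * (\<beta>\<^sup>2 - \<beta> * q) + \<beta>\<^sup>2 * r * ln ((1 + 1/\<beta>) / r) - \<beta>\<^sup>2 < 1"
proof -
  \<comment> \<open>\<open>R\<close> is the value of \<open>r\<close> at which the left-hand side is maximal; the maximum is \<open>\<beta>\<^sup>2 * (R - 1)\<close>.\<close>
  define R where "R = (1 + 1/\<beta>) * exp (- (q / \<beta>))"
  have pos: "1 + 1/\<beta> > 0" "R > 0" "\<beta>\<^sup>2 + 1 > 0" "\<beta>\<^sup>2 + \<beta> > 0"
    using assms by (auto simp: R_def add_pos_pos add_nonneg_pos)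
  have "(\<beta>\<^sup>2 + \<beta>) / (\<beta>\<^sup>2 + 1) < exp (q / \<beta>)"
    using cond pos by (metis divide_pos_pos exp_less_mono exp_ln)
  then have "(\<beta>\<^sup>2 + \<beta>) * exp (- (q / \<beta>)) < \<beta>\<^sup>2 + 1"
    using pos by (simp add: exp_minus field_simps)
  moreover have "\<beta>\<^sup>2 * R = (\<beta>\<^sup>2 + \<beta>) * exp (- (q / \<beta>))"
    using assms by (simp add: R_def field_simps power2_eq_square)
  ultimately have R: "\<beta>\<^sup>2 * R < \<beta>\<^sup>2 + 1" by simp
  have "ln (R / r) \<le> R / r - 1"
    using pos assms by (intro ln_le_minus_one) auto
  then have "r * ln (R / r) \<le> R - r"
    using assms by (simp add: field_simps)
  moreover have "ln (R / r) = ln ((1 + 1/\<beta>) / r) - q / \<beta>"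
    using pos assms by (simp add: R_def ln_div ln_mult)
  ultimately have "\<beta>\<^sup>2 * (r * (ln ((1 + 1/\<beta>) / r) - q / \<beta>)) \<le> \<beta>\<^sup>2 * (R - r)"
    by (intro mult_left_mono) auto
  moreover have "\<beta>\<^sup>2 * (r * (ln ((1 + 1/\<beta>) / r) - q / \<beta>)) = \<beta>\<^sup>2 * r * ln ((1 + 1/\<beta>) / r) - r * \<beta> * q"
    using assms by (simp add: field_simps power2_eq_square)
  ultimately show ?thesis using R by (simp add: algebra_simps)
qed

text \<open>The exceptional points are collected in one null set \<open>N\<close>, and an essential
  bound \<open>L\<close> of \<open>a\<close> enters only through integrals. In this form the
  assumptions pass to \<open>- x\<close> and to the exponentially weighted solution, so the maximum
  principle can be applied to both.\<close>

locale delay_solution =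
  fixes m :: nat and a :: "real \<Rightarrow> real" and b h :: "nat \<Rightarrow> real \<Rightarrow> real" and x :: "real \<Rightarrow> real"
    and N :: "real set" and L :: real
  assumes a_integrable: "\<And>T. a integrable_on {0..T}"
    and a_nonneg: "\<And>t. t \<ge> 0 \<Longrightarrow> a t \<ge> 0"
    and a_integral_le: "\<And>s t. 0 \<le> s \<Longrightarrow> s \<le> t \<Longrightarrow> integral {s..t} a \<le> L * (t - s)"
    and ac: "\<And>T. T \<ge> 0 \<Longrightarrow> abs_cont_on 0 T x"
    and N: "negligible N"
    and deriv: "\<And>t. t \<ge> 0 \<Longrightarrow> t \<notin> N \<Longrightarrow>
      (x has_real_derivative - (a t * x t) - (\<Sum>k=1..m. b k t * x (h k t))) (at t)"
begin

definition A :: "real \<Rightarrow> real" where "A t = integral {0..t} a"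

lemma A_diff: "0 \<le> s \<Longrightarrow> s \<le> t \<Longrightarrow> A t - A s = integral {s..t} a"
  using Henstock_Kurzweil_Integration.integral_combine[of 0 s t a] a_integrable by (simp add: A_def)

lemma A_mono: "0 \<le> s \<Longrightarrow> s \<le> t \<Longrightarrow> A s \<le> A t"
  using A_diff[of s t] a_nonneg integral_nonneg[of a "{s..t}"] a_integrable[of t]
  by (auto simp: integrable_on_subinterval)

lemma A_lipschitz: "0 \<le> s \<Longrightarrow> s \<le> t \<Longrightarrow> \<bar>A t - A s\<bar> \<le> L * (t - s)"
  using A_diff[of s t] a_integral_le[of s t] A_mono[of s t] by auto

lemma abs_cont_A: "0 \<le> p \<Longrightarrow> abs_cont_on p q A"
  by (rule abs_cont_on_lipschitz[of _ _ _ L]) (auto intro: A_lipschitz)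

lemma continuous_A: "0 \<le> p \<Longrightarrow> continuous_on {p..q} A"
  by (intro abs_cont_on_imp_continuous_on abs_cont_A)

lemma continuous_x: "0 \<le> p \<Longrightarrow> continuous_on {p..q} x"
  by (cases "q \<ge> 0") (auto intro!: abs_cont_on_imp_continuous_on abs_cont_on_subinterval[OF ac[of q]])

text \<open>With the integrating factor \<open>exp (A t)\<close> the assumed bound says that
  \<open>(x t - c) * exp (A t) - c' * A t\<close> has a nonpositive derivative almost everywhere.
  The driving term \<open>c' * exp (- A t)\<close> is resonant with the homogeneous equation, whence
  the summand linear in \<open>A\<close>.\<close>

lemma comparison:
  assumes pq: "0 \<le> p" "p \<le> q"
    and le: "\<And>t. p \<le> t \<Longrightarrow> t \<le> q \<Longrightarrow> - (\<Sum>k=1..m. b k t * x (h k t)) \<le> a t * (c + c' * exp (- A t))"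
  shows "(x q - c) * exp (A q) - c' * A q \<le> (x p - c) * exp (A p) - c' * A p"
proof -
  define Z where "Z = {t \<in> {0<..<q}. \<not> (A has_real_derivative a t) (at t)}"
  have Z: "negligible Z"
    using negligible_not_deriv_indefinite_integral[OF a_integrable[of q]] by (simp add: Z_def A_def[abs_def])
  have eA: "abs_cont_on p q (\<lambda>t. exp (A t))"
  proof (rule abs_cont_on_dominated[OF abs_cont_A abs_cont_A])
    fix u v assume uv: "p \<le> u" "u \<le> v" "v \<le> q"
    have "A u \<le> A v" "A v \<le> A q" using uv pq by (auto intro!: A_mono)
    \<comment> \<open>The tangent line of the exponential at \<open>A v\<close> shows that it is
      Lipschitz on the values taken by \<open>A\<close>.\<close>
    have "exp (A v) * (1 + (A u - A v)) \<le> exp (A v) * exp (A u - A v)"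
      by (intro mult_left_mono exp_ge_add_one_self) auto
    then have "exp (A v) - exp (A u) \<le> exp (A v) * (A v - A u)"
      by (simp add: exp_diff algebra_simps)
    also have "\<dots> \<le> exp (A q) * (A v - A u)"
      using \<open>A u \<le> A v\<close> \<open>A v \<le> A q\<close> by (intro mult_right_mono) auto
    finally show "\<bar>exp (A v) - exp (A u)\<bar> \<le> exp (A q) / 2 * (\<bar>A v - A u\<bar> + \<bar>A v - A u\<bar>)"
      using \<open>A u \<le> A v\<close> by (simp add: field_simps)
  qed (use pq in auto)
  have const: "abs_cont_on p q (\<lambda>_. l)" for l
    by (rule abs_cont_on_lipschitz[of _ _ _ 0]) simp
  have "abs_cont_on p q x"
    by (rule abs_cont_on_subinterval[OF ac[of q]]) (use pq in auto)
  then have "abs_cont_on p q (\<lambda>t. (x t - c) * exp (A t) - c' * A t)"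
    by (intro abs_cont_on_diff[OF abs_cont_on_mult[OF abs_cont_on_diff[OF _ const] eA]
        abs_cont_on_mult[OF const abs_cont_A[OF pq(1)]]])
  then show ?thesis
  proof (rule abs_cont_on_nonincreasing[OF _ pq(2), of _ "insert 0 (insert q (N \<union> Z))"])
    \<comment> \<open>The points \<open>0\<close> and \<open>q\<close> are added because
      \<open>Z\<close> only accounts for the open interval between them.\<close>
    show "negligible (insert 0 (insert q (N \<union> Z)))" using N Z by simp
    fix t assume t: "t \<in> {p..q} - insert 0 (insert q (N \<union> Z))"
    then have [derivative_intros]: "(A has_real_derivative a t) (at t)"
      using pq by (auto simp: Z_def)
    have [derivative_intros]: "(x has_real_derivative - (a t * x t) - (\<Sum>k=1..m. b k t * x (h k t))) (at t)"
      using pq t by (intro deriv) auto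
    define D where "D = exp (A t) * (- (\<Sum>k=1..m. b k t * x (h k t)) - a t * (c + c' * exp (- A t)))"
    have "((\<lambda>t. (x t - c) * exp (A t) - c' * A t) has_real_derivative
       (- (a t * x t) - (\<Sum>k=1..m. b k t * x (h k t))) * exp (A t) + (x t - c) * (exp (A t) * a t) - c' * a t) (at t)"
      by (rule derivative_eq_intros refl)+ simp
    also have "(- (a t * x t) - (\<Sum>k=1..m. b k t * x (h k t))) * exp (A t) + (x t - c) * (exp (A t) * a t) - c' * a t = D"
      by (simp add: D_def algebra_simps exp_minus)
    finally have "((\<lambda>t. (x t - c) * exp (A t) - c' * A t) has_real_derivative D) (at t)" .
    moreover have "D \<le> 0" unfolding D_def
      using le[of t] t by (intro mult_nonneg_nonpos) auto
    ultimately show "\<exists>D\<le>0. ((\<lambda>t. (x t - c) * exp (A t) - c' * A t) has_real_derivative D) (at t)"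
      by (intro exI[of _ D] conjI)
  qed
qed

text \<open>From \<open>T0\<close> on the bounds on delay and gain hold; from \<open>T1\<close> on
  delayed arguments lie after \<open>T0\<close>, where the backward estimate is available; from
  \<open>T2\<close> on they lie after \<open>T1\<close>. Only a positive peak is treated, the
  negative one being a peak of \<open>- x\<close>. The bound
  \<open>ln (1 + 1/\<beta>) \<le> H\<close> places the switch between the two estimates of the
  delayed values no earlier than the zero \<open>s1\<close>.\<close>

lemma no_new_peak:
  fixes \<beta> H M T0 T1 T2 s0 :: real
  assumes b_nonneg: "\<And>k t. k \<in> {1..m} \<Longrightarrow> t \<ge> 0 \<Longrightarrow> b k t \<ge> 0"
    and T: "0 \<le> T0" "T0 \<le> T1" "T1 \<le> T2"
    and T0: "\<And>k t. k \<in> {1..m} \<Longrightarrow> t \<ge> T0 \<Longrightarrow> 0 \<le> h k t \<and> h k t \<le> t \<and> A t - A (h k t) \<le> H"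
    and b_le: "\<And>t. t \<ge> T0 \<Longrightarrow> (\<Sum>k=1..m. b k t) \<le> \<beta> * a t"
    and T1: "\<And>k t. k \<in> {1..m} \<Longrightarrow> t \<ge> T1 \<Longrightarrow> T0 \<le> h k t"
    and T2: "\<And>k t. k \<in> {1..m} \<Longrightarrow> t \<ge> T2 \<Longrightarrow> T1 \<le> h k t"
    and "\<beta> > 0" and H: "ln (1 + 1/\<beta>) \<le> H"
    and cond: "ln ((\<beta>\<^sup>2 + \<beta>) / (\<beta>\<^sup>2 + 1)) < exp (- H) / \<beta>"
    and "M > 0" "s0 > T2" "x s0 = M"
    and bnd: "\<And>t. 0 \<le> t \<Longrightarrow> t \<le> s0 \<Longrightarrow> \<bar>x t\<bar> \<le> M"
    and bnd2: "\<And>t. 0 \<le> t \<Longrightarrow> t \<le> T2 \<Longrightarrow> \<bar>x t\<bar> < M"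
  shows False
proof -
  have feedback: "- (\<Sum>k=1..m. b k t * x (h k t)) \<le> a t * (\<beta> * c)"
    if "t \<ge> T0" "c \<ge> 0" "\<And>k. k \<in> {1..m} \<Longrightarrow> - x (h k t) \<le> c" for t c
  proof -
    have "- (\<Sum>k=1..m. b k t * x (h k t)) = (\<Sum>k=1..m. b k t * (- x (h k t)))"
      by (simp add: sum_negf)
    also have "\<dots> \<le> (\<Sum>k=1..m. b k t * c)"
      using that b_nonneg T by (intro sum_mono mult_left_mono) auto
    also have "\<dots> = (\<Sum>k=1..m. b k t) * c" by (simp add: sum_distrib_right)
    also have "\<dots> \<le> \<beta> * a t * c" using b_le[OF that(1)] that(2) by (intro mult_right_mono) auto
    finally show ?thesis by (simp add: algebra_simps)
  qed
  \<comment> \<open>Since the delayed arguments at times after \<open>T2\<close> are at least \<open>T1\<close>, a solution positive on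
    \<open>{T1..s0}\<close> could not rise after \<open>T2\<close>. The last zero \<open>s1\<close> before the peak therefore exists, and
    estimates backwards from \<open>s1\<close> are available for the delayed arguments at times after \<open>s1\<close>.\<close>
  define Z where "Z = {t \<in> {T1..s0}. x t = 0}"
  have cx: "continuous_on {T1..s0} x" using T by (intro continuous_x) auto
  have ivt: "\<exists>z\<ge>t. z \<le> s0 \<and> x z = 0" if "T1 \<le> t" "t \<le> s0" "x t \<le> 0" for t
    by (rule IVT') (use that \<open>x s0 = M\<close> \<open>M > 0\<close> continuous_on_subset[OF cx, of "{t..s0}"] in auto)
  have "Z \<noteq> {}"
  proof
    assume "Z = {}"
    have xpos: "x t > 0" if "T1 \<le> t" "t \<le> s0" for t
    proof (rule ccontr)
      assume "\<not> x t > 0"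
      with ivt[OF that] obtain z where "t \<le> z" "z \<le> s0" "x z = 0" by auto
      then show False using \<open>Z = {}\<close> that unfolding Z_def by auto
    qed
    have "(x s0 - 0) * exp (A s0) - 0 * A s0 \<le> (x T2 - 0) * exp (A T2) - 0 * A T2"
    proof (rule comparison)
      fix t assume t: "T2 \<le> t" "t \<le> s0"
      have "- x (h k t) \<le> 0" if "k \<in> {1..m}" for k
        using xpos[of "h k t"] T2[OF that t(1)] T0[OF that, of t] t T by auto
      from feedback[OF _ _ this] t T
      show "- (\<Sum>k=1..m. b k t * x (h k t)) \<le> a t * (0 + 0 * exp (- A t))" by auto
    qed (use T \<open>s0 > T2\<close> in auto)
    also have "\<dots> \<le> x T2 * exp (A s0)"
      using xpos[of T2] T \<open>s0 > T2\<close> A_mono[of T2 s0] by simp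
    finally have "x s0 \<le> x T2" by simp
    then show False using bnd2[of T2] T \<open>x s0 = M\<close> by auto
  qed
  define s1 where "s1 = Sup Z"
  have "closed Z"
    unfolding Z_def by (intro continuous_closed_preimage_constant cx) auto
  have bdd: "bdd_above Z" by (auto simp: Z_def)
  have "s1 \<in> Z" unfolding s1_def
    using closed_contains_Sup \<open>Z \<noteq> {}\<close> bdd \<open>closed Z\<close> by blast
  then have s1: "T1 \<le> s1" "s1 \<le> s0" "x s1 = 0" by (auto simp: Z_def)
  have s1_ge: "z \<le> s1" if "z \<in> Z" for z
    unfolding s1_def using that bdd by (rule cSup_upper)
  \<comment> \<open>A negative value would be followed by a zero, as \<open>x s0 > 0\<close>; no
    zero lies beyond \<open>s1\<close>.\<close>
  have xnn: "x t \<ge> 0" if t: "s1 \<le> t" "t \<le> s0" for t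
  proof (rule ccontr)
    assume "\<not> x t \<ge> 0"
    with ivt[of t] t s1(1) obtain z where z: "t \<le> z" "z \<le> s0" "x z = 0" by auto
    with s1_ge[of z] t s1 have "z = t" unfolding Z_def by auto
    with z \<open>\<not> x t \<ge> 0\<close> show False by simp
  qed
  \<comment> \<open>Only the crude bound \<open>- x \<le> M\<close> on delayed values is used. Read
    with \<open>q = s1\<close> this controls \<open>x\<close> before its zero, and with
    \<open>p = s1\<close> after it.\<close>
  have phase1: "(x q - \<beta> * M) * exp (A q) - 0 * A q \<le> (x p - \<beta> * M) * exp (A p) - 0 * A p"
    if pq: "T0 \<le> p" "p \<le> q" "q \<le> s0" for p q
  proof (rule comparison)
    fix t assume t: "p \<le> t" "t \<le> q"
    have "- x (h k t) \<le> M" if "k \<in> {1..m}" for k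
      using bnd[of "h k t"] T0[OF that, of t] t pq by auto
    from feedback[OF _ _ this] t pq \<open>M > 0\<close>
    show "- (\<Sum>k=1..m. b k t * x (h k t)) \<le> a t * (\<beta> * M + 0 * exp (- A t))" by auto
  qed (use pq T in auto)
  have cancel: "y * exp u * exp (- u) = y" for y u :: real
    by (simp add: mult.assoc exp_add[symmetric])
  have before: "- x u \<le> \<beta> * M * (exp (A s1 - A u) - 1)" if "T0 \<le> u" "u \<le> s1" for u
  proof -
    have "- (\<beta> * M) * exp (A s1) \<le> (x u - \<beta> * M) * exp (A u)"
      using phase1[of u s1] that s1 by simp
    then have "- (\<beta> * M) * exp (A s1) * exp (- A u) \<le> (x u - \<beta> * M) * exp (A u) * exp (- A u)"
      by (intro mult_right_mono) auto
    then show ?thesis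
      unfolding cancel by (simp add: exp_diff exp_minus divide_inverse algebra_simps)
  qed
  have after: "x t \<le> \<beta> * M * (1 - exp (A s1 - A t))" if "s1 \<le> t" "t \<le> s0" for t
  proof -
    have "(x t - \<beta> * M) * exp (A t) \<le> - (\<beta> * M) * exp (A s1)"
      using phase1[of s1 t] that s1 T by simp
    then have "(x t - \<beta> * M) * exp (A t) * exp (- A t) \<le> - (\<beta> * M) * exp (A s1) * exp (- A t)"
      by (intro mult_right_mono) auto
    then show ?thesis
      unfolding cancel by (simp add: exp_diff exp_minus divide_inverse algebra_simps)
  qed
  \<comment> \<open>Once \<open>A t - A s1\<close> exceeds \<open>H\<close>, every delayed argument
    lies after \<open>s1\<close>, where \<open>x\<close> is nonnegative; the cut-off at 0 expresses
    this.\<close>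
  define E where "E t = max 0 (exp (H + A s1 - A t) - 1)" for t
  have delayed: "- x (h k t) \<le> \<beta> * M * E t" if k: "k \<in> {1..m}" and t: "s1 \<le> t" "t \<le> s0" for k t
  proof (cases "h k t \<le> s1")
    case True
    have hk: "T0 \<le> h k t" "A t - A (h k t) \<le> H"
      using T1[OF k, of t] T0[OF k, of t] t s1 T by auto
    have "- x (h k t) \<le> \<beta> * M * (exp (A s1 - A (h k t)) - 1)"
      using hk True by (intro before)
    also have "\<dots> \<le> \<beta> * M * E t"
      using hk \<open>\<beta> > 0\<close> \<open>M > 0\<close> by (intro mult_left_mono) (auto simp: E_def intro!: max.coboundedI2)
    finally show ?thesis .
  next
    case False
    then have "x (h k t) \<ge> 0"
      using T0[OF k, of t] t s1 T by (intro xnn) auto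
    moreover have "\<beta> * M * E t \<ge> 0" using \<open>\<beta> > 0\<close> \<open>M > 0\<close> by (auto simp: E_def)
    ultimately show ?thesis by linarith
  qed
  have feedback': "- (\<Sum>k=1..m. b k t * x (h k t)) \<le> a t * (\<beta> * (\<beta> * M * E t))"
    if "s1 \<le> t" "t \<le> s0" for t
    using that s1 T \<open>\<beta> > 0\<close> \<open>M > 0\<close> by (intro feedback delayed) (auto simp: E_def)
  define q where "q = exp (- H)"
  note pf = peak_factor_less_one[OF \<open>\<beta> > 0\<close> _ cond[folded q_def]]
  \<comment> \<open>\<open>A t - A s1 = H - ln R\<close> is the moment at which \<open>\<beta> * E t\<close> drops below 1: up to then the trivial bound
    \<open>M\<close> on the delayed values is the better one, afterwards the backward estimate.\<close>
  define R where "R = 1 + 1 / \<beta>"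
  have R: "R > 0" "\<beta> * R = \<beta> + 1" using \<open>\<beta> > 0\<close> by (auto simp: R_def field_simps)
  \<comment> \<open>This is the peak estimate at \<open>r = R\<close>, where the logarithm vanishes:
    the phase governed by the crude bound ends below \<open>M\<close>.\<close>
  have first: "\<beta> * M * (1 - q * R) < M"
  proof -
    have "R * (\<beta>\<^sup>2 - \<beta> * q) - \<beta>\<^sup>2 < 1"
      using pf[OF R(1)] R by (simp add: R_def)
    moreover have "R * (\<beta>\<^sup>2 - \<beta> * q) = \<beta> * R * (\<beta> - q)" by (simp add: algebra_simps power2_eq_square)
    ultimately have "\<beta> - q * (\<beta> + 1) < 1" unfolding R(2) by (simp add: algebra_simps power2_eq_square)
    moreover have "\<beta> * M * (1 - q * R) = M * (\<beta> - q * (\<beta> * R))" by (simp add: algebra_simps)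
    ultimately show ?thesis using R \<open>M > 0\<close> by simp
  qed
  have expR: "exp (- (H - ln R)) = q * R" using R by (simp add: q_def exp_diff exp_minus field_simps)
  show False
  proof (cases "A s0 - A s1 \<le> H - ln R")
    case True
    have "M \<le> \<beta> * M * (1 - exp (A s1 - A s0))" using after[of s0] s1 \<open>x s0 = M\<close> by simp
    also have "\<dots> \<le> \<beta> * M * (1 - exp (- (H - ln R)))"
      using True \<open>\<beta> > 0\<close> \<open>M > 0\<close> by (intro mult_left_mono) auto
    also have "\<dots> < M" using first by (simp only: expR)
    finally show False by simp
  next
    case False
    have cA: "continuous_on {s1..s0} A" using s1 T by (intro continuous_A) auto
    \<comment> \<open>The point \<open>s2\<close> stands in for the peak at a time when
      \<open>E\<close> still has its exponential form. After \<open>A t - A s1 = H\<close> the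
      feedback is nonpositive, so \<open>x t * exp (A t)\<close> cannot increase and
      \<open>x\<close> was already at least \<open>M\<close> at that moment.\<close>
    obtain s2 where s2: "s1 \<le> s2" "s2 \<le> s0" "A s2 - A s1 \<le> H" "H - ln R \<le> A s2 - A s1" "M \<le> x s2"
    proof (cases "A s0 - A s1 \<le> H")
      case True
      then show ?thesis using that[of s0] s1 False \<open>x s0 = M\<close> by auto
    next
      case F: False
      have "H - ln R \<ge> 0" "ln R \<ge> 0" using H \<open>\<beta> > 0\<close> by (auto simp: R_def)
      then have "\<exists>s\<ge>s1. s \<le> s0 \<and> A s = A s1 + H"
        by (intro IVT' cA) (use F s1 in auto)
      then obtain s where s: "s1 \<le> s" "s \<le> s0" "A s = A s1 + H" by auto
      have "(x s0 - 0) * exp (A s0) - 0 * A s0 \<le> (x s - 0) * exp (A s) - 0 * A s"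
      proof (rule comparison)
        fix t assume t: "s \<le> t" "t \<le> s0"
        have "A s \<le> A t" using t s s1 T by (intro A_mono) auto
        then have "E t = 0" using s by (simp add: E_def)
        then show "- (\<Sum>k=1..m. b k t * x (h k t)) \<le> a t * (0 + 0 * exp (- A t))"
          using feedback'[of t] t s by simp
      qed (use s s1 T in auto)
      also have "\<dots> \<le> x s * exp (A s0)"
        using xnn[of s] s s1 T A_mono[of s s0] by (simp add: mult_left_mono)
      finally have "M \<le> x s" using \<open>x s0 = M\<close> by simp
      then show ?thesis using that[of s] s \<open>ln R \<ge> 0\<close> by auto
    qed
    have "H - ln R \<ge> 0" using H by (simp add: R_def)
    then have "\<exists>s\<ge>s1. s \<le> s2 \<and> A s = A s1 + (H - ln R)"
      by (intro IVT') (use s2 continuous_on_subset[OF cA, of "{s1..s2}"] in auto)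
    then obtain s where s: "s1 \<le> s" "s \<le> s2" "A s = A s1 + (H - ln R)" by auto
    define c where "c = \<beta>\<^sup>2 * M"
    \<comment> \<open>Here \<open>\<beta> * (\<beta> * M * E t)\<close> equals
      \<open>- c + c * exp (H + A s1) * exp (- A t)\<close>, which is the form treated by
      \<open>comparison\<close>; the resonant part produces the logarithm below.\<close>
    have "(x s2 - (- c)) * exp (A s2) - (c * exp (H + A s1)) * A s2
        \<le> (x s - (- c)) * exp (A s) - (c * exp (H + A s1)) * A s"
    proof (rule comparison)
      fix t assume t: "s \<le> t" "t \<le> s2"
      have "A t \<le> A s2" using t s s1 T by (intro A_mono) auto
      then have "E t = exp (H + A s1 - A t) - 1" using s2 by (simp add: E_def)
      also have "exp (H + A s1 - A t) = exp (H + A s1) * exp (- A t)"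
        by (simp add: exp_add[symmetric])
      finally have "\<beta> * (\<beta> * M * E t) = - c + c * exp (H + A s1) * exp (- A t)"
        by (simp add: c_def power2_eq_square right_diff_distrib)
      with feedback'[of t] t s s2
      show "- (\<Sum>k=1..m. b k t * x (h k t)) \<le> a t * (- c + c * exp (H + A s1) * exp (- A t))"
        by simp
    qed (use s s1 T in auto)
    then have *: "(x s2 + c) * exp (A s2) \<le> (x s + c) * exp (A s) + c * exp (H + A s1) * (A s2 - A s)"
      by (simp add: algebra_simps)
    have "(x s2 + c) * exp (A s2) * exp (- A s2) \<le> ((x s + c) * exp (A s) + c * exp (H + A s1) * (A s2 - A s)) * exp (- A s2)"
      by (intro mult_right_mono *) auto
    moreover have "((x s + c) * exp (A s) + c * exp (H + A s1) * (A s2 - A s)) * exp (- A s2)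
        = (x s + c) * exp (A s - A s2) + c * exp (H + A s1 - A s2) * (A s2 - A s)"
      by (simp add: exp_diff exp_minus exp_add divide_inverse algebra_simps)
    ultimately have main: "x s2 + c \<le> (x s + c) * exp (A s - A s2) + c * exp (H + A s1 - A s2) * (A s2 - A s)"
      unfolding cancel by simp
    \<comment> \<open>By the choice of \<open>s\<close>, \<open>R / r\<close> is
      \<open>exp (A s2 - A s)\<close>; in terms of \<open>r\<close> the bound becomes
      \<open>M\<close> times the expression in \<open>peak_factor_less_one\<close>.\<close>
    define r where "r = exp (H + A s1 - A s2)"
    have "r > 0" by (simp add: r_def)
    have lnr: "A s2 - A s = ln (R / r)"
      using R by (simp add: ln_div r_def s(3))
    have rR: "exp (A s - A s2) = r / R"
    proof -
      have "exp (A s - A s2) = exp (- ln (R / r))" using lnr by simp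
      also have "\<dots> = r / R" using R \<open>r > 0\<close> by (simp add: exp_minus)
      finally show ?thesis .
    qed
    have "x s \<le> \<beta> * M * (1 - q * R)"
      using after[of s] s s2 expR by (simp add: minus_diff_eq)
    then have "(x s + c) * (r / R) \<le> (\<beta> * M * (1 - q * R) + c) * (r / R)"
      using R \<open>r > 0\<close> by (intro mult_right_mono) auto
    with main have "x s2 + c \<le> (\<beta> * M * (1 - q * R) + c) * (r / R) + c * r * ln (R / r)"
      unfolding rR lnr r_def[symmetric] by linarith
    also have "(\<beta> * M * (1 - q * R) + c) * (r / R) = M * (r * (\<beta>\<^sup>2 - \<beta> * q))"
    proof -
      have "\<beta> * (1 - q * R) = \<beta> - q * (\<beta> * R)" "R * (\<beta>\<^sup>2 - \<beta> * q) = \<beta> * R * (\<beta> - q)"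
        by (simp_all add: algebra_simps power2_eq_square)
      then have eq: "\<beta> * (1 - q * R) + \<beta>\<^sup>2 = R * (\<beta>\<^sup>2 - \<beta> * q)"
        unfolding R(2) by (simp add: algebra_simps power2_eq_square)
      have "\<beta> * M * (1 - q * R) + c = M * (\<beta> * (1 - q * R) + \<beta>\<^sup>2)"
        by (simp add: c_def algebra_simps)
      also note eq
      finally show ?thesis using R(1) by simp
    qed
    finally have "x s2 \<le> M * (r * (\<beta>\<^sup>2 - \<beta> * q) + \<beta>\<^sup>2 * r * ln (R / r) - \<beta>\<^sup>2)"
      by (simp add: c_def algebra_simps)
    also have "\<dots> < M * 1"
      using pf[OF \<open>r > 0\<close>] \<open>M > 0\<close> by (intro mult_strict_left_mono) (auto simp: R_def)
    finally show False using s2 by simp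
  qed
qed

lemma delay_solution_uminus: "delay_solution m a b h (\<lambda>t. - x t) N L"
proof
  fix t :: real assume "t \<ge> 0" "t \<notin> N"
  from DERIV_minus[OF deriv[OF this]]
  show "((\<lambda>t. - x t) has_real_derivative - (a t * - x t) - (\<Sum>k=1..m. b k t * - x (h k t))) (at t)"
    by (simp add: sum_negf add.commute)
qed (use a_integrable a_nonneg a_integral_le N abs_cont_on_uminus[OF ac] in auto)

text \<open>If the bound failed at \<open>t\<close>, the maximum of the absolute value over
  \<open>{0..t}\<close> would exceed \<open>R\<close> and be attained after \<open>T2\<close>, so it
  would be a new peak of \<open>x\<close> or of \<open>- x\<close>.\<close>

lemma abs_le_initial_bound:
  fixes \<beta> H R T0 T1 T2 :: real
  assumes b_nonneg: "\<And>k t. k \<in> {1..m} \<Longrightarrow> t \<ge> 0 \<Longrightarrow> b k t \<ge> 0"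
    and T: "0 \<le> T0" "T0 \<le> T1" "T1 \<le> T2"
    and T0: "\<And>k t. k \<in> {1..m} \<Longrightarrow> t \<ge> T0 \<Longrightarrow> 0 \<le> h k t \<and> h k t \<le> t \<and> A t - A (h k t) \<le> H"
    and b_le: "\<And>t. t \<ge> T0 \<Longrightarrow> (\<Sum>k=1..m. b k t) \<le> \<beta> * a t"
    and T1: "\<And>k t. k \<in> {1..m} \<Longrightarrow> t \<ge> T1 \<Longrightarrow> T0 \<le> h k t"
    and T2: "\<And>k t. k \<in> {1..m} \<Longrightarrow> t \<ge> T2 \<Longrightarrow> T1 \<le> h k t"
    and \<beta>: "\<beta> > 0" and H: "ln (1 + 1/\<beta>) \<le> H"
    and cond: "ln ((\<beta>\<^sup>2 + \<beta>) / (\<beta>\<^sup>2 + 1)) < exp (- H) / \<beta>"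
    and R: "\<And>t. 0 \<le> t \<Longrightarrow> t \<le> T2 \<Longrightarrow> \<bar>x t\<bar> \<le> R"
    and "t \<ge> 0"
  shows "\<bar>x t\<bar> \<le> R"
proof (rule ccontr)
  assume gt: "\<not> \<bar>x t\<bar> \<le> R"
  have "continuous_on {0..t} (\<lambda>s. \<bar>x s\<bar>)" by (intro continuous_intros continuous_x) simp
  then obtain s0 where s0: "s0 \<in> {0..t}" "\<And>s. s \<in> {0..t} \<Longrightarrow> \<bar>x s\<bar> \<le> \<bar>x s0\<bar>"
    using continuous_attains_sup[of "{0..t}" "\<lambda>s. \<bar>x s\<bar>"] \<open>t \<ge> 0\<close> by auto
  define M where "M = \<bar>x s0\<bar>"
  have M: "M > R" using s0(2)[of t] gt \<open>t \<ge> 0\<close> by (simp add: M_def)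
  have "R \<ge> 0" using R[of 0] T by linarith
  have "s0 > T2" using R[of s0] M s0(1) by (force simp: M_def)
  have small: "\<bar>x s\<bar> < M" if "0 \<le> s" "s \<le> T2" for s using R[OF that] M by linarith
  have bnd: "\<bar>x s\<bar> \<le> M" if "0 \<le> s" "s \<le> s0" for s using s0 that by (simp add: M_def)
  interpret neg: delay_solution m a b h "\<lambda>t. - x t" N L by (rule delay_solution_uminus)
  show False
  proof (cases "x s0 \<ge> 0")
    case True
    show False
      by (rule no_new_peak[OF b_nonneg T T0 b_le T1 T2 \<beta> H cond, of M s0])
        (use True \<open>s0 > T2\<close> M \<open>R \<ge> 0\<close> small bnd in \<open>auto simp: M_def\<close>)
  next
    case False
    show False
      by (rule neg.no_new_peak[OF b_nonneg T T0 b_le T1 T2 \<beta> H cond, of M s0])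
        (use False \<open>s0 > T2\<close> M \<open>R \<ge> 0\<close> small bnd in \<open>auto simp: M_def\<close>)
  qed
qed

text \<open>A uniform bound on \<open>exp (\<gamma> * t) * x t\<close> is exponential decay of
  \<open>x\<close>. By the product rule weighting lowers \<open>a\<close> by \<open>\<gamma>\<close>
  and multiplies each \<open>b k t\<close> by the exponential of \<open>\<gamma>\<close> times the
  lag.\<close>

lemma delay_solution_weighted:
  assumes \<gamma>: "\<gamma> \<ge> 0" "\<And>t. t \<ge> 0 \<Longrightarrow> \<gamma> \<le> a t"
  shows "delay_solution m (\<lambda>t. a t - \<gamma>) (\<lambda>k t. b k t * exp (\<gamma> * (t - h k t))) h (\<lambda>t. exp (\<gamma> * t) * x t) N L"
proof
  fix T :: real
  show "(\<lambda>t. a t - \<gamma>) integrable_on {0..T}" using a_integrable by (intro integrable_diff) auto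
next
  fix s t :: real assume st: "0 \<le> s" "s \<le> t"
  have "a integrable_on {s..t}" using a_integrable[of t] st by (auto intro: integrable_on_subinterval)
  then have "integral {s..t} (\<lambda>t. a t - \<gamma>) \<le> integral {s..t} a"
    using \<gamma>(1) by (intro integral_le integrable_diff) auto
  also have "\<dots> \<le> L * (t - s)" by (rule a_integral_le[OF st])
  finally show "integral {s..t} (\<lambda>t. a t - \<gamma>) \<le> L * (t - s)" .
next
  fix T :: real assume "T \<ge> 0"
  have "abs_cont_on 0 T (\<lambda>t. exp (\<gamma> * t))"
  proof (rule abs_cont_on_lipschitz)
    fix u v :: real assume uv: "0 \<le> u" "u \<le> v" "v \<le> T"
    have "\<gamma> * u \<le> \<gamma> * v" "\<gamma> * v \<le> \<gamma> * T" using uv \<gamma>(1) by (auto intro: mult_left_mono)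
    have "exp (\<gamma> * v) * (1 + (\<gamma> * u - \<gamma> * v)) \<le> exp (\<gamma> * v) * exp (\<gamma> * u - \<gamma> * v)"
      by (intro mult_left_mono exp_ge_add_one_self) auto
    then have "exp (\<gamma> * v) - exp (\<gamma> * u) \<le> exp (\<gamma> * v) * (\<gamma> * v - \<gamma> * u)"
      by (simp add: exp_diff algebra_simps)
    also have "\<dots> \<le> exp (\<gamma> * T) * (\<gamma> * v - \<gamma> * u)"
      using \<open>\<gamma> * u \<le> \<gamma> * v\<close> \<open>\<gamma> * v \<le> \<gamma> * T\<close> by (intro mult_right_mono) auto
    finally show "\<bar>exp (\<gamma> * v) - exp (\<gamma> * u)\<bar> \<le> exp (\<gamma> * T) * \<gamma> * (v - u)"
      using \<open>\<gamma> * u \<le> \<gamma> * v\<close> by (simp add: algebra_simps)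
  qed
  then show "abs_cont_on 0 T (\<lambda>t. exp (\<gamma> * t) * x t)"
    by (intro abs_cont_on_mult ac \<open>T \<ge> 0\<close>)
next
  fix t :: real assume t: "t \<ge> 0" "t \<notin> N"
  note deriv[OF t, derivative_intros]
  have "((\<lambda>t. exp (\<gamma> * t) * x t) has_real_derivative
      exp (\<gamma> * t) * \<gamma> * x t + exp (\<gamma> * t) * (- (a t * x t) - (\<Sum>k=1..m. b k t * x (h k t)))) (at t)"
    by (rule derivative_eq_intros refl)+ simp
  also have "exp (\<gamma> * t) * \<gamma> * x t + exp (\<gamma> * t) * (- (a t * x t) - (\<Sum>k=1..m. b k t * x (h k t)))
      = - ((a t - \<gamma>) * (exp (\<gamma> * t) * x t)) - (\<Sum>k=1..m. exp (\<gamma> * t) * (b k t * x (h k t)))"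
    by (simp add: algebra_simps sum_distrib_left)
  also have "(\<Sum>k=1..m. exp (\<gamma> * t) * (b k t * x (h k t)))
      = (\<Sum>k=1..m. b k t * exp (\<gamma> * (t - h k t)) * (exp (\<gamma> * h k t) * x (h k t)))"
  proof (rule sum.cong[OF refl])
    fix k
    have "exp (\<gamma> * t) = exp (\<gamma> * (t - h k t)) * exp (\<gamma> * h k t)"
      by (simp add: exp_add[symmetric] algebra_simps)
    then show "exp (\<gamma> * t) * (b k t * x (h k t))
      = b k t * exp (\<gamma> * (t - h k t)) * (exp (\<gamma> * h k t) * x (h k t))" by simp
  qed
  finally show "((\<lambda>t. exp (\<gamma> * t) * x t) has_real_derivative
      - ((a t - \<gamma>) * (exp (\<gamma> * t) * x t))
      - (\<Sum>k=1..m. b k t * exp (\<gamma> * (t - h k t)) * (exp (\<gamma> * h k t) * x (h k t)))) (at t)" .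
qed (use \<gamma> N in auto)

text \<open>With \<open>M\<close> the maximum up to the end of a step of length
  \<open>1 / (2 * C)\<close>, the derivative is at most \<open>C * M\<close> in absolute value, so
  \<open>x\<close> changes by at most \<open>M / 2\<close> within the step. Hence \<open>M\<close>
  is at most twice the previous bound. This controls \<open>x\<close> up to the time from which the
  maximum principle takes over.\<close>

lemma abs_le_doubling:
  assumes b_nonneg: "\<And>k t. k \<in> {1..m} \<Longrightarrow> t \<ge> 0 \<Longrightarrow> b k t \<ge> 0"
    and h_le: "\<And>k t. k \<in> {1..m} \<Longrightarrow> t \<ge> 0 \<Longrightarrow> h k t \<le> t"
    and C: "C > 0" "\<And>t. t \<ge> 0 \<Longrightarrow> t \<notin> N \<Longrightarrow> a t + (\<Sum>k=1..m. b k t) \<le> C"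
    and R: "\<And>t. t \<le> 0 \<Longrightarrow> \<bar>x t\<bar> \<le> R"
  shows "t \<le> real n / (2 * C) \<Longrightarrow> \<bar>x t\<bar> \<le> 2 ^ n * R"
proof (induction n arbitrary: t)
  case 0
  then show ?case using R by simp
next
  case (Suc n)
  define p q where "p = real n / (2 * C)" and "q = real (Suc n) / (2 * C)"
  have pq: "0 \<le> p" "p \<le> q" "q - p = 1 / (2 * C)"
    using C(1) by (auto simp: p_def q_def field_simps)
  have "R \<ge> 0" using R[of 0] by linarith
  have "continuous_on {0..q} (\<lambda>s. \<bar>x s\<bar>)" by (intro continuous_intros continuous_x) simp
  then obtain s0 where s0: "s0 \<in> {0..q}" "\<And>s. s \<in> {0..q} \<Longrightarrow> \<bar>x s\<bar> \<le> \<bar>x s0\<bar>"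
    using continuous_attains_sup[of "{0..q}" "\<lambda>s. \<bar>x s\<bar>"] pq by auto
  define M where "M = \<bar>x s0\<bar>"
  have M: "M \<le> 2 ^ Suc n * R"
  proof (rule ccontr)
    assume gt: "\<not> M \<le> 2 ^ Suc n * R"
    have R2: "2 ^ n * R \<ge> 0" using \<open>R \<ge> 0\<close> by simp
    have ih: "\<bar>x s\<bar> \<le> 2 ^ n * R" if "s \<le> p" for s using Suc.IH that by (simp add: p_def)
    have "s0 > p" using ih[of s0] gt R2 by (force simp: M_def)
    have past: "\<bar>x s\<bar> \<le> M" if "s \<le> q" for s
    proof (cases "s \<ge> 0")
      case True
      then show ?thesis using s0(2)[of s] that by (simp add: M_def)
    next
      case False
      then show ?thesis using ih[of s] gt R2 pq by simp
    qed
    have "\<bar>x s0 - x p\<bar> \<le> C * M * (s0 - p)"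
    proof (rule abs_cont_on_lipschitz_of_deriv[OF _ _ N])
      show "abs_cont_on p s0 x"
        by (rule abs_cont_on_subinterval[OF ac[of s0]]) (use pq \<open>s0 > p\<close> in auto)
      fix t assume "t \<in> {p..s0} - N"
      then have t: "t \<ge> 0" "t \<notin> N" "t \<le> q" using pq s0(1) by auto
      have "\<bar>- (a t * x t) - (\<Sum>k=1..m. b k t * x (h k t))\<bar> \<le> \<bar>a t * x t\<bar> + \<bar>\<Sum>k=1..m. b k t * x (h k t)\<bar>"
        by linarith
      also have "\<dots> \<le> a t * M + (\<Sum>k=1..m. b k t * M)"
      proof (rule add_mono)
        show "\<bar>a t * x t\<bar> \<le> a t * M"
          using a_nonneg[OF t(1)] past[OF t(3)] by (simp add: abs_mult mult_left_mono)
        have "\<bar>\<Sum>k=1..m. b k t * x (h k t)\<bar> \<le> (\<Sum>k=1..m. \<bar>b k t * x (h k t)\<bar>)" by (rule sum_abs)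
        also have "\<dots> \<le> (\<Sum>k=1..m. b k t * M)"
        proof (rule sum_mono)
          fix k assume k: "k \<in> {1..m}"
          have "\<bar>x (h k t)\<bar> \<le> M" using h_le[OF k t(1)] t(3) by (intro past) simp
          then show "\<bar>b k t * x (h k t)\<bar> \<le> b k t * M"
            using b_nonneg[OF k t(1)] by (simp add: abs_mult mult_left_mono)
        qed
        finally show "\<bar>\<Sum>k=1..m. b k t * x (h k t)\<bar> \<le> (\<Sum>k=1..m. b k t * M)" .
      qed
      also have "\<dots> = (a t + (\<Sum>k=1..m. b k t)) * M" by (simp add: sum_distrib_right distrib_right)
      also have "\<dots> \<le> C * M" using C(2)[OF t(1,2)] by (intro mult_right_mono) (auto simp: M_def)
      finally have "\<bar>- (a t * x t) - (\<Sum>k=1..m. b k t * x (h k t))\<bar> \<le> C * M" .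
      then show "\<exists>D. \<bar>D\<bar> \<le> C * M \<and> (x has_real_derivative D) (at t)"
        using deriv[OF t(1,2)] by (intro exI conjI)
    qed (use \<open>s0 > p\<close> in auto)
    also have "\<dots> \<le> C * M * (q - p)" using C(1) s0(1) by (intro mult_left_mono) (auto simp: M_def)
    also have "\<dots> = M / 2" using C(1) by (simp add: pq(3))
    finally have "\<bar>x s0 - x p\<bar> \<le> M / 2" .
    then show False using ih[of p] gt unfolding M_def power_Suc mult.assoc by linarith
  qed
  show ?case
  proof (cases "t \<ge> 0")
    case True
    then show ?thesis using s0(2)[of t] M Suc.prems by (simp add: M_def q_def)
  next
    case False
    then have "\<bar>x t\<bar> \<le> R" using R by simp
    also have "\<dots> \<le> 2 ^ Suc n * R"
      using mult_right_mono[OF one_le_power[of 2 "Suc n"] \<open>R \<ge> 0\<close>] by simp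
    finally show ?thesis .
  qed
qed

end

subsection \<open>Choice of parameters\<close>

lemma AE_half_line_negligible:
  fixes P :: "real \<Rightarrow> bool"
  assumes "AE t in lebesgue_on {0..}. P t"
  shows "\<exists>N. negligible N \<and> (\<forall>t. t \<ge> 0 \<longrightarrow> t \<notin> N \<longrightarrow> P t)"
proof -
  have "AE t in lebesgue. t \<in> {0..} \<longrightarrow> P t"
    using assms by (subst (asm) AE_restrict_space_iff) auto
  then obtain N where N: "N \<in> null_sets lebesgue" "{t \<in> space lebesgue. \<not> (t \<in> {0..} \<longrightarrow> P t)} \<subseteq> N"
    unfolding eventually_ae_filter by (elim bexE)
  show ?thesis
    by (rule exI[of _ N]) (use N in \<open>auto simp: negligible_iff_null_sets\<close>)
qed

lemma set_integrable_of_ess_bounded: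
  fixes a :: "real \<Rightarrow> real"
  assumes meas: "a \<in> borel_measurable (lebesgue_on {0..})" and N: "negligible N"
    and bnd: "\<And>t. t \<ge> 0 \<Longrightarrow> t \<notin> N \<Longrightarrow> \<bar>a t\<bar> \<le> C" and "0 \<le> u"
  shows "set_integrable lebesgue {u..v} a"
proof -
  have "a \<in> borel_measurable (lebesgue_on {u..v})"
    by (rule measurable_restrict_mono[OF meas]) (use \<open>0 \<le> u\<close> in auto)
  then have "(\<lambda>t. indicator {u..v} t *\<^sub>R a t) \<in> borel_measurable lebesgue"
    by (subst (asm) borel_measurable_restrict_space_iff) auto
  moreover have "AE t in lebesgue. t \<notin> N"
    using N by (simp add: negligible_iff_null_sets AE_not_in)
  then have "AE t in lebesgue. t \<in> {u..v} \<longrightarrow> norm (indicator {u..v} t *\<^sub>R a t) \<le> C"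
    by (rule AE_mp) (use bnd \<open>0 \<le> u\<close> in \<open>auto intro!: AE_I2\<close>)
  ultimately show ?thesis
    unfolding set_integrable_def
    by (intro integrableI_bounded_set[where A = "{u..v}" and B = C]) (auto simp: emeasure_lborel_Icc_eq)
qed

lemma integral_le_of_ess_bounded:
  fixes a :: "real \<Rightarrow> real"
  assumes int: "a integrable_on {s..t}" and N: "negligible N" and "s \<le> t"
    and bnd: "\<And>r. r \<in> {s..t} - N \<Longrightarrow> a r \<le> C"
  shows "integral {s..t} a \<le> C * (t - s)"
proof -
  define a' where "a' r = (if r \<in> N then C else a r)" for r
  have "a' integrable_on {s..t}"
    by (rule integrable_spike[OF int N]) (simp add: a'_def)
  moreover have "integral {s..t} a = integral {s..t} a'"
    by (rule integral_spike[OF N]) (simp add: a'_def)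
  moreover have "a' r \<le> C" if "r \<in> {s..t}" for r
    using bnd that by (simp add: a'_def)
  ultimately have "integral {s..t} a \<le> integral {s..t} (\<lambda>_. C)"
    using integral_le[of a' "{s..t}" "\<lambda>_. C"] by (simp add: integrable_const_ivl del: Henstock_Kurzweil_Integration.integral_const_real)
  then show ?thesis using \<open>s \<le> t\<close> by (simp add: mult.commute)
qed

text \<open>For \<open>\<beta> > 0\<close> both sides are continuous, so the strict inequality
  survives a small increase of \<open>\<beta>\<close> and \<open>h0\<close>. The case
  \<open>\<beta> = 0\<close>, in which the term with \<open>1 / \<beta>\<close> is to be read as
  infinite, is separate because division by zero yields 0; there \<open>1/2\<close> serves since it
  makes the logarithm negative.\<close>

lemma stability_condition_perturbed:
  fixes \<beta> h0 :: real
  assumes "\<beta> \<ge> 0" and cond: "\<beta> = 0 \<or> 1 / \<beta> * exp (- h0) > ln ((\<beta>\<^sup>2 + \<beta>) / (\<beta>\<^sup>2 + 1))"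
  obtains \<beta>' H where "\<beta> < \<beta>'" "h0 < H" "ln ((\<beta>'\<^sup>2 + \<beta>') / (\<beta>'\<^sup>2 + 1)) < exp (- H) / \<beta>'"
proof (cases "\<beta> = 0")
  case True
  have "ln (((1/2)\<^sup>2 + 1/2) / ((1/2)\<^sup>2 + 1) :: real) < 0"
    by (intro ln_less_zero) (auto simp: power2_eq_square)
  also have "0 < exp (- (h0 + 1)) / (1/2)" by simp
  finally show ?thesis using that[of "1/2" "h0 + 1"] True by simp
next
  case False
  define F where "F s = exp (- (h0 + s)) / (\<beta> + s) - ln (((\<beta> + s)\<^sup>2 + (\<beta> + s)) / ((\<beta> + s)\<^sup>2 + 1))" for s
  have pos: "\<beta> > 0" using False \<open>\<beta> \<ge> 0\<close> by simp
  have nz: "\<beta>\<^sup>2 + \<beta> > 0" "\<beta>\<^sup>2 + 1 > 0" using pos by (auto intro: add_pos_pos)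
  have "F \<midarrow>0\<rightarrow> exp (- (h0 + 0)) / (\<beta> + 0) - ln (((\<beta> + 0)\<^sup>2 + (\<beta> + 0)) / ((\<beta> + 0)\<^sup>2 + 1))"
    unfolding F_def by (intro tendsto_intros) (use pos nz in auto)
  moreover have "exp (- (h0 + 0)) / (\<beta> + 0) - ln (((\<beta> + 0)\<^sup>2 + (\<beta> + 0)) / ((\<beta> + 0)\<^sup>2 + 1)) > 0"
    using cond False by simp
  ultimately have "eventually (\<lambda>s. F s > 0) (at 0)" by (rule order_tendstoD)
  then obtain d where "d > 0" "\<And>s. s \<noteq> 0 \<Longrightarrow> dist s 0 < d \<Longrightarrow> F s > 0"
    unfolding eventually_at by auto
  from \<open>d > 0\<close> this(2)[of "d/2"] have "F (d/2) > 0" by (simp add: dist_real_def)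
  then show ?thesis using that[of "\<beta> + d/2" "h0 + d/2"] \<open>d > 0\<close> by (simp add: F_def)
qed

text \<open>It allows a smaller delay bound to be raised to \<open>ln (1 + 1/\<beta>)\<close>. There
  the right-hand side is \<open>1 / (\<beta> + 1)\<close>, while \<open>ln y \<le> y - 1\<close>
  bounds the left-hand side by \<open>(\<beta> - 1) / (\<beta>\<^sup>2 + 1)\<close>.\<close>

lemma stability_condition_at_threshold:
  fixes \<beta> :: real
  assumes "\<beta> > 0"
  shows "ln ((\<beta>\<^sup>2 + \<beta>) / (\<beta>\<^sup>2 + 1)) < exp (- ln (1 + 1/\<beta>)) / \<beta>"
proof -
  have pos: "\<beta>\<^sup>2 + 1 > 0" "\<beta>\<^sup>2 + \<beta> > 0" "1 + 1/\<beta> > 0" using assms by (auto intro: add_pos_pos)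
  have "ln ((\<beta>\<^sup>2 + \<beta>) / (\<beta>\<^sup>2 + 1)) \<le> (\<beta>\<^sup>2 + \<beta>) / (\<beta>\<^sup>2 + 1) - 1"
    using pos by (intro ln_le_minus_one divide_pos_pos)
  also have "\<dots> = (\<beta> - 1) / (\<beta>\<^sup>2 + 1)" using pos by (simp add: field_simps)
  also have "\<dots> < 1 / (\<beta> + 1)"
    using pos assms by (simp add: divide_simps power2_eq_square algebra_simps)
  also have "\<beta> + 1 = (1 + 1/\<beta>) * \<beta>" using assms by (simp add: field_simps)
  also have "1 / ((1 + 1/\<beta>) * \<beta>) = exp (- ln (1 + 1/\<beta>)) / \<beta>"
    using pos by (simp add: exp_minus inverse_eq_divide)
  finally show ?thesis .
qed

text \<open>The two factors are the cost of weighting: the first bounds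
  \<open>a / (a - \<gamma>)\<close> when \<open>a \<ge> a0\<close>, the second the growth over a lag
  of at most \<open>H / a0\<close>. Both tend to 1 as \<open>\<gamma>\<close> tends to 0.\<close>

lemma exponential_weight_exists:
  fixes \<beta>1 \<beta>2 a0 H :: real
  assumes "\<beta>1 < \<beta>2" "a0 > 0"
  obtains \<gamma> where "0 < \<gamma>" "\<gamma> < a0" "\<beta>1 * (a0 / (a0 - \<gamma>)) * exp (\<gamma> * (H / a0)) < \<beta>2"
proof -
  define G where "G \<gamma> = \<beta>1 * (a0 / (a0 - \<gamma>)) * exp (\<gamma> * (H / a0))" for \<gamma>
  have "G \<midarrow>0\<rightarrow> \<beta>1 * (a0 / (a0 - 0)) * exp (0 * (H / a0))"
    unfolding G_def by (intro tendsto_intros) (use assms in auto)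
  moreover have "\<beta>1 * (a0 / (a0 - 0)) * exp (0 * (H / a0)) < \<beta>2" using assms by simp
  ultimately have "eventually (\<lambda>\<gamma>. G \<gamma> < \<beta>2) (at 0)" by (rule order_tendstoD)
  then obtain d where d: "d > 0" "\<And>s. s \<noteq> 0 \<Longrightarrow> dist s 0 < d \<Longrightarrow> G s < \<beta>2"
    unfolding eventually_at by auto
  have "G (min (d/2) (a0/2)) < \<beta>2" using d(1) assms by (intro d(2)) (auto simp: dist_real_def)
  then show ?thesis using that[of "min (d/2) (a0/2)"] d(1) assms by (simp add: G_def)
qed

subsection \<open>Exponential stability\<close>

theorem theorem3:
  fixes m :: nat
    and a :: "real \<Rightarrow> real"
    and b h :: "nat \<Rightarrow> real \<Rightarrow> real"
    and a\<^sub>0 h\<^sub>0 \<beta> :: real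
  assumes "m \<ge> 1"
    and "a \<in> borel_measurable (lebesgue_on {0..})"
    and "ess_bounded a"
    and "\<And>k. k \<in> {1..m} \<Longrightarrow> b k \<in> borel_measurable (lebesgue_on {0..})"
    and "\<And>k. k \<in> {1..m} \<Longrightarrow> ess_bounded (b k)"
    and "\<And>k t. k \<in> {1..m} \<Longrightarrow> t \<ge> 0 \<Longrightarrow> b k t \<ge> 0"
    and "\<And>k. k \<in> {1..m} \<Longrightarrow> h k \<in> borel_measurable (lebesgue_on {0..})"
    and "\<And>k t. k \<in> {1..m} \<Longrightarrow> t \<ge> 0 \<Longrightarrow> h k t \<le> t"
    and "\<And>k. k \<in> {1..m} \<Longrightarrow> filterlim (h k) at_top at_top"
    and "a\<^sub>0 > 0"
    and "\<And>t. t \<ge> 0 \<Longrightarrow> a t \<ge> a\<^sub>0"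
    and "Limsup at_top
           (\<lambda>t. ereal (LINT s:{Min ((\<lambda>k. h k t) ` {1..m})..t}|lebesgue. a s)) = ereal h\<^sub>0"
    and "Limsup at_top (\<lambda>t. ereal ((\<Sum>k=1..m. b k t) / a t)) = ereal \<beta>"
    and "\<beta> = 0 \<or> 1 / \<beta> * exp (- h\<^sub>0) > ln ((\<beta>\<^sup>2 + \<beta>) / (\<beta>\<^sup>2 + 1))"
  shows "exponentially_stable m a b h"
proof -
  note b_nonneg = assms(6) and h_le = assms(8) and a0 = assms(10) and a_ge = assms(11)

  \<comment> \<open>Uniform bounds and integrals of the coefficients\<close>
  obtain Ca where "AE t in lebesgue_on {0..}. \<bar>a t\<bar> \<le> Ca"
    using assms(3) unfolding ess_bounded_def by (elim exE)
  from AE_half_line_negligible[OF this]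
  obtain Na where Na: "negligible Na" "\<And>t. t \<ge> 0 \<Longrightarrow> t \<notin> Na \<Longrightarrow> \<bar>a t\<bar> \<le> Ca"
    by auto
  have "\<forall>k. \<exists>C N. k \<in> {1..m} \<longrightarrow> negligible N \<and> (\<forall>t. t \<ge> 0 \<longrightarrow> t \<notin> N \<longrightarrow> b k t \<le> C)"
  proof
    fix k
    show "\<exists>C N. k \<in> {1..m} \<longrightarrow> negligible N \<and> (\<forall>t. t \<ge> 0 \<longrightarrow> t \<notin> N \<longrightarrow> b k t \<le> C)"
    proof (cases "k \<in> {1..m}")
      case True
      then obtain C where C: "AE t in lebesgue_on {0..}. \<bar>b k t\<bar> \<le> C"
        using assms(5) unfolding ess_bounded_def by blast
      from AE_half_line_negligible[OF C]
      obtain N where "negligible N" "\<forall>t. t \<ge> 0 \<longrightarrow> t \<notin> N \<longrightarrow> \<bar>b k t\<bar> \<le> C" by (elim exE conjE)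
      then show ?thesis by (intro exI[of _ C] exI[of _ N]) auto
    qed auto
  qed
  then obtain Cb Nb where Nb: "\<forall>k. k \<in> {1..m} \<longrightarrow> negligible (Nb k) \<and> (\<forall>t. t \<ge> 0 \<longrightarrow> t \<notin> Nb k \<longrightarrow> b k t \<le> Cb k)"
    by (metis (no_types))
  \<comment> \<open>One constant serves all coefficients outside one null set; the absolute values
    and the \<open>+ 1\<close> make it positive.\<close>
  define C where "C = \<bar>Ca\<bar> + (\<Sum>k=1..m. \<bar>Cb k\<bar>) + 1"
  have "C > 0" unfolding C_def by (intro add_nonneg_pos add_nonneg_nonneg sum_nonneg) auto
  define N0 where "N0 = Na \<union> (\<Union>k\<in>{1..m}. Nb k)"
  have N0: "negligible N0" unfolding N0_def using Na Nb by (intro negligible_Un negligible_Union) auto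
  have coeff_le: "a t + (\<Sum>k=1..m. b k t) \<le> C" if "t \<ge> 0" "t \<notin> N0" for t
  proof -
    have "a t \<le> \<bar>Ca\<bar>" using Na(2)[of t] that by (auto simp: N0_def)
    moreover have "(\<Sum>k=1..m. b k t) \<le> (\<Sum>k=1..m. \<bar>Cb k\<bar>)"
    proof (rule sum_mono)
      fix k assume k: "k \<in> {1..m}"
      with that have "b k t \<le> Cb k" using Nb by (auto simp: N0_def)
      then show "b k t \<le> \<bar>Cb k\<bar>" by simp
    qed
    ultimately show ?thesis by (simp add: C_def)
  qed
  have si: "set_integrable lebesgue {u..v} a" if "0 \<le> u" for u v
    by (rule set_integrable_of_ess_bounded[OF assms(2) Na that])
  have a_int: "a integrable_on {u..v}" if "0 \<le> u" for u v
    using set_lebesgue_integral_eq_integral(1)[OF si[OF that]] by simp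
  \<comment> \<open>The Lebesgue integral in the definition of \<open>h\<^sub>0\<close> is exchanged
    for the gauge integral. The lower limit is nonnegative once all delayed arguments are.\<close>
  have LINT_eq: "(LINT s:{u..v}|lebesgue. a s) = integral {u..v} a" if "0 \<le> u" for u v
    using set_lebesgue_integral_eq_integral(2)[OF si[OF that]] by simp
  have a_le: "integral {s..t} a \<le> \<bar>Ca\<bar> * (t - s)" if "0 \<le> s" "s \<le> t" for s t
  proof (rule integral_le_of_ess_bounded[OF a_int Na(1)])
    fix r assume "r \<in> {s..t} - Na"
    then have "\<bar>a r\<bar> \<le> Ca" using that by (intro Na(2)) auto
    then show "a r \<le> \<bar>Ca\<bar>" by simp
  qed (use that in auto)
  have ratio_nonneg: "(\<Sum>k=1..m. b k t) / a t \<ge> 0" if "t \<ge> 0" for t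
    using b_nonneg that a_ge[OF that] a0 by (intro divide_nonneg_pos sum_nonneg) auto

  \<comment> \<open>Choice of the constants\<close>
  have "\<beta> \<ge> 0"
  proof (rule ccontr)
    assume "\<not> \<beta> \<ge> 0"
    then have "Limsup at_top (\<lambda>t. ereal ((\<Sum>k=1..m. b k t) / a t)) < ereal 0" using assms(13) by simp
    from Limsup_lessD[OF this] have "eventually (\<lambda>t. (\<Sum>k=1..m. b k t) / a t < 0) at_top" by simp
    then have "eventually (\<lambda>t::real. False) at_top"
      using eventually_ge_at_top[of 0] by eventually_elim (use ratio_nonneg in force)
    then show False by simp
  qed
  obtain \<beta>' H where \<beta>': "\<beta> < \<beta>'" and H: "h\<^sub>0 < H"
    and condH: "ln ((\<beta>'\<^sup>2 + \<beta>') / (\<beta>'\<^sup>2 + 1)) < exp (- H) / \<beta>'"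
    by (rule stability_condition_perturbed[OF \<open>\<beta> \<ge> 0\<close> assms(14)])
  have "\<beta>' > 0" using \<beta>' \<open>\<beta> \<ge> 0\<close> by simp
  \<comment> \<open>\<open>no_new_peak\<close> needs \<open>ln (1 + 1/\<beta>') \<le> H\<close>; enlarging the delay bound to this value is harmless.\<close>
  define H' where "H' = max H (ln (1 + 1/\<beta>'))"
  have H': "H \<le> H'" "ln (1 + 1/\<beta>') \<le> H'" by (auto simp: H'_def)
  have condH': "ln ((\<beta>'\<^sup>2 + \<beta>') / (\<beta>'\<^sup>2 + 1)) < exp (- H') / \<beta>'"
    using condH stability_condition_at_threshold[OF \<open>\<beta>' > 0\<close>] by (auto simp: H'_def max_def)
  \<comment> \<open>The limit superior makes the gain eventually smaller than
    \<open>\<beta>1\<close>; the remaining room up to \<open>\<beta>'\<close> absorbs the cost of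
    weighting.\<close>
  define \<beta>1 where "\<beta>1 = (\<beta> + \<beta>') / 2"
  have \<beta>1: "\<beta> < \<beta>1" "\<beta>1 < \<beta>'" "\<beta>1 > 0" using \<beta>' \<open>\<beta> \<ge> 0\<close> by (auto simp: \<beta>1_def)
  obtain \<gamma> where \<gamma>: "0 < \<gamma>" "\<gamma> < a\<^sub>0" "\<beta>1 * (a\<^sub>0 / (a\<^sub>0 - \<gamma>)) * exp (\<gamma> * (H / a\<^sub>0)) < \<beta>'"
    by (rule exponential_weight_exists[OF \<beta>1(2) a0])

  \<comment> \<open>Threshold times\<close>
  have h_ev: "eventually (\<lambda>t. \<forall>k\<in>{1..m}. c \<le> h k t) at_top" for c
    using assms(9) by (intro eventually_ball_finite) (auto simp: filterlim_at_top)
  have "eventually (\<lambda>t. (LINT s:{Min ((\<lambda>k. h k t) ` {1..m})..t}|lebesgue. a s) < H) at_top"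
    using Limsup_lessD[of at_top "\<lambda>t. ereal (LINT s:{Min ((\<lambda>k. h k t) ` {1..m})..t}|lebesgue. a s)" "ereal H"]
      H assms(12) by simp
  moreover have "eventually (\<lambda>t. (\<Sum>k=1..m. b k t) / a t < \<beta>1) at_top"
    using Limsup_lessD[of at_top "\<lambda>t. ereal ((\<Sum>k=1..m. b k t) / a t)" "ereal \<beta>1"] \<beta>1 assms(13) by simp
  ultimately have "eventually (\<lambda>t. 0 \<le> t \<and> (\<forall>k\<in>{1..m}. 0 \<le> h k t) \<and> (\<Sum>k=1..m. b k t) / a t < \<beta>1
      \<and> (LINT s:{Min ((\<lambda>k. h k t) ` {1..m})..t}|lebesgue. a s) < H) at_top"
    using h_ev[of 0] eventually_ge_at_top[of 0] by eventually_elim simp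
  then obtain T0 where T0: "\<forall>t\<ge>T0. 0 \<le> t \<and> (\<forall>k\<in>{1..m}. 0 \<le> h k t) \<and> (\<Sum>k=1..m. b k t) / a t < \<beta>1
      \<and> (LINT s:{Min ((\<lambda>k. h k t) ` {1..m})..t}|lebesgue. a s) < H"
    unfolding eventually_at_top_linorder by (elim exE)
  have "T0 \<ge> 0" using T0 by simp
  have delay_le: "integral {h k t..t} a \<le> H" if k: "k \<in> {1..m}" and t: "t \<ge> T0" for k t
  proof -
    let ?u = "Min ((\<lambda>k. h k t) ` {1..m})"
    have u: "?u \<le> h k t" "0 \<le> ?u" using T0 k t by (auto intro!: Min_le)
    have "integral {h k t..t} a \<le> integral {?u..t} a"
    proof (intro integral_subset_le a_int u ballI)
      show "0 \<le> a s" if "s \<in> {?u..t}" for s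
        using a_ge[of s] a0 u(2) that by (auto intro: order_trans[OF u(2)])
    qed (use u in auto)
    then show ?thesis using T0 t LINT_eq[OF u(2), of t] by fastforce
  qed
  \<comment> \<open>Because \<open>a \<ge> a\<^sub>0\<close>, a delay bounded in the time scale
    \<open>A\<close> is bounded in the original time, which keeps the exponential factors in the
    weighted gain bounded.\<close>
  have lag_le: "t - h k t \<le> H / a\<^sub>0" if k: "k \<in> {1..m}" and t: "t \<ge> T0" for k t
  proof -
    have ht: "0 \<le> h k t" "h k t \<le> t" using T0 k t h_le[OF k, of t] by auto
    have "integral {h k t..t} (\<lambda>_. a\<^sub>0) \<le> integral {h k t..t} a"
      using ht a_ge by (intro integral_le a_int) auto
    then have "a\<^sub>0 * (t - h k t) \<le> H" using delay_le[OF k t] ht by (simp add: mult.commute)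
    then show ?thesis using a0 by (simp add: field_simps)
  qed
  obtain T1' where "\<forall>t\<ge>T1'. \<forall>k\<in>{1..m}. T0 \<le> h k t"
    using h_ev[of T0] unfolding eventually_at_top_linorder by (elim exE)
  then obtain T1 where T1: "T0 \<le> T1" "\<And>k t. k \<in> {1..m} \<Longrightarrow> t \<ge> T1 \<Longrightarrow> T0 \<le> h k t"
    using that[of "max T0 T1'"] by auto
  obtain T2' where "\<forall>t\<ge>T2'. \<forall>k\<in>{1..m}. T1 \<le> h k t"
    using h_ev[of T1] unfolding eventually_at_top_linorder by (elim exE)
  then obtain T2 where T2: "T1 \<le> T2" "\<And>k t. k \<in> {1..m} \<Longrightarrow> t \<ge> T2 \<Longrightarrow> T1 \<le> h k t"
    using that[of "max T1 T2'"] by auto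
  have "T2 \<ge> 0" using \<open>T0 \<ge> 0\<close> T1 T2 by simp
  \<comment> \<open>The number \<open>n\<close> of doubling steps of length
    \<open>1 / (2 * C)\<close> that cover \<open>{0..T2}\<close>.\<close>
  obtain n :: nat where "T2 * (2 * C) \<le> real n" using real_arch_simple by blast
  then have n: "T2 \<le> real n / (2 * C)" using \<open>C > 0\<close> by (simp add: field_simps)

  \<comment> \<open>Decay of a given solution\<close>
  show ?thesis
    unfolding exponentially_stable_def
  proof (intro exI conjI allI impI)
    \<comment> \<open>The constant bounds the weighted solution on \<open>{0..T2}\<close> relative
      to the norm of the initial function: \<open>2 ^ n\<close> comes from doubling, the exponential
      from the weight. It depends on neither the initial function nor the solution.\<close>
    show "exp (\<gamma> * T2) * 2 ^ n > 0" by simp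
    show "\<gamma> > 0" by (rule \<gamma>)
    fix \<phi> x and t :: real
    assume \<phi>: "initial_function \<phi>" and sol: "is_solution m a b h \<phi> x" and "t \<ge> 0"
    define S where "S = sup_norm \<phi>"
    have past: "\<bar>x s\<bar> \<le> S" if "s \<le> 0" for s
    proof -
      have "bdd_above ((\<lambda>t. \<bar>\<phi> t\<bar>) ` {..0})"
        using \<phi> by (auto simp: initial_function_def bounded_iff bdd_above_def)
      then have "\<bar>\<phi> s\<bar> \<le> S" unfolding S_def sup_norm_def using that by (intro cSUP_upper) auto
      then show ?thesis using sol that by (simp add: is_solution_def)
    qed
    have "AE t in lebesgue_on {0..}. x differentiable (at t) \<and>
        deriv x t + a t * x t + (\<Sum>k=1..m. b k t * x (h k t)) = 0"
      using sol by (simp add: is_solution_def)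
    from AE_half_line_negligible[OF this] obtain Nx where Nx: "negligible Nx" "\<And>t. t \<ge> 0 \<Longrightarrow> t \<notin> Nx \<Longrightarrow> x differentiable (at t) \<and>
        deriv x t + a t * x t + (\<Sum>k=1..m. b k t * x (h k t)) = 0"
      by auto
    \<comment> \<open>This null set depends on the solution, but all constants were fixed before
      it.\<close>
    define N where "N = N0 \<union> Nx"
    interpret delay_solution m a b h x N "\<bar>Ca\<bar>"
    proof
      show "negligible N" unfolding N_def using N0 Nx by (intro negligible_Un)
      show "abs_cont_on 0 T x" if "T \<ge> 0" for T using sol that by (simp add: is_solution_def)
      show "0 \<le> a t" if "t \<ge> 0" for t using a_ge[OF that] a0 by simp
      fix t :: real assume "t \<ge> 0" "t \<notin> N"
      with Nx(2)[of t] have "(x has_real_derivative deriv x t) (at t)"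
        and "deriv x t = - (a t * x t) - (\<Sum>k=1..m. b k t * x (h k t))"
        by (auto simp: N_def DERIV_deriv_iff_real_differentiable)
      then show "(x has_real_derivative - (a t * x t) - (\<Sum>k=1..m. b k t * x (h k t))) (at t)"
        by simp
    qed (use a_int a_le in auto)
    interpret w: delay_solution m "\<lambda>t. a t - \<gamma>" "\<lambda>k t. b k t * exp (\<gamma> * (t - h k t))" h
        "\<lambda>t. exp (\<gamma> * t) * x t" N "\<bar>Ca\<bar>"
      using \<gamma> a_ge by (intro delay_solution_weighted) force+
    have start: "\<bar>exp (\<gamma> * s) * x s\<bar> \<le> exp (\<gamma> * T2) * (2 ^ n * S)" if "0 \<le> s" "s \<le> T2" for s
    proof -
      have "\<bar>x s\<bar> \<le> 2 ^ n * S"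
        by (rule abs_le_doubling[OF b_nonneg h_le \<open>C > 0\<close> _ past])
          (use coeff_le that n in \<open>auto simp: N_def\<close>)
      moreover have "exp (\<gamma> * s) \<le> exp (\<gamma> * T2)" using \<gamma> that by simp
      ultimately show ?thesis unfolding abs_mult by (intro mult_mono) auto
    qed
    have "\<bar>exp (\<gamma> * t) * x t\<bar> \<le> exp (\<gamma> * T2) * (2 ^ n * S)"
    \<comment> \<open>The maximum principle is applied to the weighted equation. Its delays,
      measured with \<open>a - \<gamma>\<close>, do not exceed those measured with \<open>a\<close>,
      and its gain relative to \<open>a - \<gamma>\<close> is at most
      \<open>\<beta>'\<close>.\<close>
    proof (rule w.abs_le_initial_bound[OF _ \<open>T0 \<ge> 0\<close> T1(1) T2(1) _ _ T1(2) T2(2) \<open>\<beta>' > 0\<close> H'(2) condH' start \<open>t \<ge> 0\<close>])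
      fix k t assume k: "k \<in> {1..m}"
      show "0 \<le> b k t * exp (\<gamma> * (t - h k t))" if "t \<ge> 0" using b_nonneg[OF k that] by simp
      assume t: "t \<ge> T0"
      have ht: "0 \<le> h k t" "h k t \<le> t" using T0 k t h_le[OF k, of t] by auto
      have "w.A t - w.A (h k t) = integral {h k t..t} (\<lambda>t. a t - \<gamma>)" by (rule w.A_diff[OF ht])
      also have "\<dots> \<le> integral {h k t..t} a"
        using \<gamma> a_int[OF ht(1)] by (intro integral_le integrable_diff) auto
      also have "\<dots> \<le> H'" using delay_le[OF k t] H' by simp
      finally show "0 \<le> h k t \<and> h k t \<le> t \<and> w.A t - w.A (h k t) \<le> H'" using ht by simp
    next
      fix t assume t: "t \<ge> T0"
      then have "t \<ge> 0" using T0 by simp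
      define e where "e = exp (\<gamma> * (H / a\<^sub>0))"
      have "(\<Sum>k=1..m. b k t * exp (\<gamma> * (t - h k t))) \<le> (\<Sum>k=1..m. b k t * e)"
      proof (rule sum_mono)
        fix k assume k: "k \<in> {1..m}"
        have "\<gamma> * (t - h k t) \<le> \<gamma> * (H / a\<^sub>0)" using lag_le[OF k t] \<gamma> by (intro mult_left_mono) auto
        then show "b k t * exp (\<gamma> * (t - h k t)) \<le> b k t * e"
          unfolding e_def using b_nonneg[OF k \<open>t \<ge> 0\<close>] by (intro mult_left_mono) auto
      qed
      also have "\<dots> = (\<Sum>k=1..m. b k t) * e" by (simp add: sum_distrib_right)
      also have "\<dots> \<le> \<beta>1 * a t * e"
      proof (rule mult_right_mono)
        have "(\<Sum>k=1..m. b k t) / a t < \<beta>1" "a t > 0" using T0 t a_ge[OF \<open>t \<ge> 0\<close>] a0 by auto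
        then show "(\<Sum>k=1..m. b k t) \<le> \<beta>1 * a t" by (simp add: field_simps)
      qed (simp add: e_def)
      also have "\<dots> \<le> \<beta>' * (a t - \<gamma>)"
      proof -
        \<comment> \<open>Cleared of denominators, this says
          \<open>\<gamma> * a\<^sub>0 \<le> \<gamma> * a t\<close>.\<close>
        have "a t \<le> a\<^sub>0 / (a\<^sub>0 - \<gamma>) * (a t - \<gamma>)"
          using \<gamma> a_ge[OF \<open>t \<ge> 0\<close>] by (simp add: field_simps)
        then have "\<beta>1 * e * a t \<le> \<beta>1 * e * (a\<^sub>0 / (a\<^sub>0 - \<gamma>) * (a t - \<gamma>))"
          using \<beta>1 by (intro mult_left_mono) (auto simp: e_def)
        also have "\<dots> = \<beta>1 * (a\<^sub>0 / (a\<^sub>0 - \<gamma>)) * e * (a t - \<gamma>)" by (simp add: algebra_simps)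
        also have "\<dots> \<le> \<beta>' * (a t - \<gamma>)"
          using \<gamma> a_ge[OF \<open>t \<ge> 0\<close>] by (intro mult_right_mono) (auto simp: e_def)
        finally show ?thesis by (simp add: algebra_simps)
      qed
      finally show "(\<Sum>k=1..m. b k t * exp (\<gamma> * (t - h k t))) \<le> \<beta>' * (a t - \<gamma>)" .
    qed
    then have "\<bar>x t\<bar> * exp (\<gamma> * t) \<le> exp (\<gamma> * T2) * 2 ^ n * S" by (simp add: abs_mult algebra_simps)
    then have "\<bar>x t\<bar> \<le> exp (\<gamma> * T2) * 2 ^ n * S / exp (\<gamma> * t)" by (simp add: pos_le_divide_eq)
    then show "\<bar>x t\<bar> \<le> exp (\<gamma> * T2) * 2 ^ n * sup_norm \<phi> * exp (- \<gamma> * t)"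
      by (simp add: S_def exp_minus divide_inverse)
  qed
qed

end
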